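(* Let $(X,\mathcal{B},\mu)$ be a standard probability space and let $T:X\to X$ be a Borel $\mu$-measure-preserving transformation. Then for every $f\in L^1(X,\mathcal{B},\mu)$ and for $\mu$-almost every $x\in X$: $|A_{f,E_x}|<\infty$ for every coherent tree $E_x\in\mathrm{CT}_x$, and the limit $$\lim_{m_x(E_x)\nearrow\infty} A_{f,E_x},$$ where $E_x$ ranges over the (finite-height) coherent trees $\mathrm{CT}_x$ rooted at $x$, exists and equals $\overline{f}(x)$, where $\overline{f}=\mathbb{E}(f\mid\mathcal{B}_{\mathcal{I}})$ is the conditional expectation of $f$ with respect to the $\sigma$-algebra $\mathcal{B}_{\mathcal{I}}$ of $T$-invariant sets.
   Context: A standard probability space $(X,\mathcal{B},\mu)$: $(X,\mathcal{B})$ is a standard Borel space and $\mu$ is a complete Borel probability measure ($\mathcal{B}$ denotes the Borel sets). A Borel map $T:X\to X$ is measure preserving if $\mu(T^{-1}[A])=\mu(A)$ for all $A\in\mathcal{B}$. A set $A\in\mathcal{B}$ is $T$-invariant if $\mu(A\triangle T^{-1}[A])=0$. No assumption is made on the cardinality of the fibres $T^{-1}\{x\}$. Disintegrations: for each $i\ge 1$, $\{\mu_x^i:x\in X\}$ denotes the disintegration of $\mu$ over $T^i$, i.e. the (almost everywhere unique) family of (complete) Borel probability measures such that for $\mu$-a.e. $x$, $\mu_x^i$ is supported on $T^{-i}\{x\}$ (that is, $\mu_x^i(X\setminus T^{-i}\{x\})=0$), and for every $E\in\mathcal{B}$ the function $x\mapsto\mu_x^i(E)$ is $\mu$-integrable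 with $\int\mu_x^i(E)\,d\mu(x)=\mu(E)$. Also $\mu_x^0=\delta_x$ is the Dirac mass at $x$. For a probability measure $\nu$ on $(X,\mathcal{B})$, $\mathrm{MALG}(\nu)$ is the measure algebra: Borel sets modulo $\nu$-null sets, with metric $d(A,B)=\nu(A\triangle B)$. Coherent trees: for $x\in X$, $\mathrm{CT}_x$ is the set of finite sequences $E_x=(E^0,E^1,\dots,E^n)$ ($n\ge 0$) such that (1) $E^0=\{x\}$ and $E^i\in\mathrm{MALG}(\mu_x^i)$ for each $i\le n$; (2) $\mu_x^i(E^i)>0$ for each $i\le n$; (3) $\mu_x^{i+1}(E^{i+1}\setminus T^{-1}[E^i])=0$ for $0\le i<n$. The length is $\ell(E_x)=n$. The mass is $m_x(E_x)=\sum_{i=0}^{n}\mu_x^i(E^i)$. The average of $f$ over $E_x$ is $$A_{f,E_x}=\frac{\sum_{i=0}^{\ell(E_x)}\int_{E^i}f(z)\,d\mu_x^i(z)}{m_x(E_x)}.$$ The statement $\lim_{m_x(E_x)\nearrow\infty}A_{f,E_x}=L$ means: for every $\varepsilon>0$ there is $R$ such that $|A_{f,E_x}-L|<\varepsilon$ for every $E_x\in\mathrm{CT}_x$ with $m_x(E_x)>R$. *)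

theory Defs
  imports "HOL-Probability.Probability"
begin

text \<open>
  Throughout, \<open>M\<close> carries the Borel \<open>\<sigma>\<close>-algebra of a standard Borel space. A complete Borel
  probability measure is given by its restriction to the Borel sets; notions that refer to the
  larger \<open>\<sigma>\<close>-algebra of measurable sets (integrability, integrals) use \<^const>\<open>completion\<close>.
\<close>

definition standard_borel_space :: "'a measure \<Rightarrow> bool" where
  "standard_borel_space M \<longleftrightarrow>
     (\<exists>X. topspace X = space M \<and> completely_metrizable_space X \<and> second_countable X \<and>
          sets M = sigma_sets (space M) {U. openin X U})"

definition standard_probability_space :: "'a measure \<Rightarrow> bool" where
  "standard_probability_space M \<longleftrightarrow> standard_borel_space M \<and> prob_space M"

definition measure_preserving_map :: "'a measure \<Rightarrow> ('a \<Rightarrow> 'a) \<Rightarrow> bool" where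
  "measure_preserving_map M T \<longleftrightarrow>
     T \<in> measurable M M \<and> (\<forall>A\<in>sets M. measure M (T -` A \<inter> space M) = measure M A)"

definition invariant_sets :: "'a measure \<Rightarrow> ('a \<Rightarrow> 'a) \<Rightarrow> 'a set set" where
  "invariant_sets M T = {A \<in> sets M. measure M (sym_diff A (T -` A \<inter> space M)) = 0}"

text \<open>
  Only the space and the sets of this measure matter; by \<open>sets_invariant_algebra\<close> below,
  generating a \<open>\<sigma>\<close>-algebra adds no new sets.
\<close>

definition invariant_algebra :: "'a measure \<Rightarrow> ('a \<Rightarrow> 'a) \<Rightarrow> 'a measure" where
  "invariant_algebra M T = sigma (space M) (invariant_sets M T)"

definition disintegration_over :: "'a measure \<Rightarrow> ('a \<Rightarrow> 'a) \<Rightarrow> ('a \<Rightarrow> 'a measure) \<Rightarrow> bool" where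
  "disintegration_over M S \<nu> \<longleftrightarrow>
     (\<forall>x\<in>space M. prob_space (\<nu> x) \<and> sets (\<nu> x) = sets M) \<and>
     (AE x in M. measure (\<nu> x) (space M - S -` {x}) = 0) \<and>
     (\<forall>E\<in>sets M. integrable (completion M) (\<lambda>x. measure (\<nu> x) E) \<and>
                  (\<integral>x. measure (\<nu> x) E \<partial>completion M) = measure M E)"

text \<open>Here \<open>\<mu> i x\<close> is \<open>\<mu>\<^sub>x\<^sup>i\<close>; the value at \<open>i = 0\<close> is the Dirac measure at \<open>x\<close>.\<close>

definition iterated_disintegrations ::
    "'a measure \<Rightarrow> ('a \<Rightarrow> 'a) \<Rightarrow> (nat \<Rightarrow> 'a \<Rightarrow> 'a measure) \<Rightarrow> bool" where
  "iterated_disintegrations M T \<mu> \<longleftrightarrow>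
     (\<forall>x\<in>space M. \<mu> 0 x = return M x) \<and>
     (\<forall>i\<ge>1. disintegration_over M (T ^^ i) (\<mu> i))"

text \<open>
  The tree \<open>(E\<^sup>0, \<dots>, E\<^sup>n)\<close> is a list of length \<open>n + 1\<close>. An element of the measure
  algebra of \<open>\<mu> i x\<close> is given by a Borel representative. All representatives are admitted, and
  the mass and the average depend only on the classes.
\<close>

definition coherent_trees ::
    "'a measure \<Rightarrow> ('a \<Rightarrow> 'a) \<Rightarrow> (nat \<Rightarrow> 'a \<Rightarrow> 'a measure) \<Rightarrow> 'a \<Rightarrow> 'a set list set" where
  "coherent_trees M T \<mu> x =
     {E. E \<noteq> [] \<and> E ! 0 = {x} \<and>
         (\<forall>i<length E. E ! i \<in> sets M \<and> measure (\<mu> i x) (E ! i) > 0) \<and>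
         (\<forall>i. Suc i < length E \<longrightarrow>
            measure (\<mu> (Suc i) x) (E ! Suc i - (T -` (E ! i) \<inter> space M)) = 0)}"

definition tree_mass :: "(nat \<Rightarrow> 'a \<Rightarrow> 'a measure) \<Rightarrow> 'a \<Rightarrow> 'a set list \<Rightarrow> real" where
  "tree_mass \<mu> x E = (\<Sum>i<length E. measure (\<mu> i x) (E ! i))"

text \<open>
  Finiteness of the average means that every integral in the numerator exists and is finite.
  It is a separate predicate because the Bochner integral is total, with value \<open>0\<close> for
  non-integrable functions.
\<close>

definition tree_average_finite ::
    "(nat \<Rightarrow> 'a \<Rightarrow> 'a measure) \<Rightarrow> ('a \<Rightarrow> real) \<Rightarrow> 'a \<Rightarrow> 'a set list \<Rightarrow> bool" where
  "tree_average_finite \<mu> f x E \<longleftrightarrow>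
     (\<forall>i<length E. set_integrable (completion (\<mu> i x)) (E ! i) f)"

definition tree_average ::
    "(nat \<Rightarrow> 'a \<Rightarrow> 'a measure) \<Rightarrow> ('a \<Rightarrow> real) \<Rightarrow> 'a \<Rightarrow> 'a set list \<Rightarrow> real" where
  "tree_average \<mu> f x E =
     (\<Sum>i<length E. LINT z:(E ! i)|completion (\<mu> i x). f z) / tree_mass \<mu> x E"

lemma sets_invariant_algebra:
  assumes "finite_measure M" and T: "T \<in> measurable M M"
  shows "sets (invariant_algebra M T) = invariant_sets M T"
proof -
  interpret finite_measure M by fact
  let ?D = "\<lambda>A. sym_diff A (T -` A \<inter> space M)"
  have D_meas: "?D A \<in> sets M" if "A \<in> sets M" for A
    using that measurable_sets[OF T that] by auto
  have inv_iff: "A \<in> invariant_sets M T \<longleftrightarrow> A \<in> sets M \<and> ?D A \<in> null_sets M" for A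
    using D_meas[of A] by (auto simp: invariant_sets_def null_sets_def emeasure_eq_measure)
  have "sigma_algebra (space M) (invariant_sets M T)"
    unfolding sigma_algebra_iff2
  proof (intro conjI ballI allI impI)
    show "invariant_sets M T \<subseteq> Pow (space M)"
      by (auto simp: invariant_sets_def dest: sets.sets_into_space)
    show "{} \<in> invariant_sets M T" by (simp add: invariant_sets_def)
  next
    fix A assume A: "A \<in> invariant_sets M T"
    have "?D (space M - A) = ?D A"
      using A T[THEN measurable_space] sets.sets_into_space[of A M] by (auto simp: inv_iff)
    with A show "space M - A \<in> invariant_sets M T" by (auto simp: inv_iff)
  next
    fix A :: "nat \<Rightarrow> 'a set" assume "range A \<subseteq> invariant_sets M T"
    then have "A i \<in> invariant_sets M T" for i by blast
    then have A: "A i \<in> sets M" "?D (A i) \<in> null_sets M" for i by (auto simp only: inv_iff)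
    have U: "(\<Union>i. A i) \<in> sets M" using A by auto
    have N: "(\<Union>i. ?D (A i)) \<in> null_sets M" using A(2) by (rule null_sets_UN)
    have "?D (\<Union>i. A i) \<subseteq> (\<Union>i. ?D (A i))" by blast
    from null_sets_subset[OF N D_meas[OF U] this] U
    show "(\<Union>i. A i) \<in> invariant_sets M T" by (simp add: inv_iff)
  qed
  then show ?thesis
    unfolding invariant_algebra_def by (rule sigma_algebra.sets_measure_of_eq)
qed

lemma subalgebra_invariant_algebra:
  assumes "finite_measure M" and "T \<in> measurable M M"
  shows "subalgebra (completion M) (invariant_algebra M T)"
  unfolding subalgebra_def sets_invariant_algebra[OF assms]
  by (auto simp: invariant_algebra_def invariant_sets_def space_measure_of_conv)

end

theory Submission
  imports Defs
begin

text \<open>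
  Let \<open>P h x\<close> be the integral of \<open>h\<close> over the fibre of \<open>T\<close> above \<open>x\<close>. Since the disintegration over
  \<open>T\<^sup>i\<^sup>+\<^sup>1\<close> is the one over \<open>T\<^sup>i\<close> followed by the one over \<open>T\<close>, the supremum of the sums of \<open>g\<close>
  over trees with at most \<open>n\<close> levels is dominated by \<open>H\<^sub>n\<close>, where \<open>H\<^sub>0 = 0\<close> and
  \<open>H\<^sub>n\<^sub>+\<^sub>1 = max 0 (g + P H\<^sub>n)\<close>. The set \<open>D\<close> where \<open>H\<^sub>n\<close> is unbounded is \<open>T\<close>-invariant, and Garsia's
  proof of the Hopf maximal inequality shows that \<open>g\<close> has nonnegative integral over \<open>D\<close>. For
  \<open>g = f - E(f | I) - \<epsilon>\<close> this integral is \<open>- \<epsilon>\<close> times the measure of \<open>D\<close>, so \<open>D\<close> is null. As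
  \<open>E(f | I)\<close> is constant along fibres, the sum of \<open>f\<close> over a tree at \<open>x\<close> exceeds
  \<open>(E(f | I) x + \<epsilon>)\<close> times the mass by at most a constant depending on \<open>x\<close>; the same holds
  for \<open>- f\<close>.
\<close>

section \<open>Kernels on standard Borel spaces\<close>

lemma standard_borel_singleton:
  assumes "standard_borel_space M" "x \<in> space M"
  shows "{x} \<in> sets M"
proof -
  obtain X where X: "topspace X = space M" "completely_metrizable_space X"
      "sets M = sigma_sets (space M) {U. openin X U}"
    using assms(1) by (auto simp: standard_borel_space_def)
  have "closedin X {x}"
    using X assms(2)
    by (simp add: closedin_Hausdorff_singleton completely_metrizable_imp_metrizable_space
        metrizable_imp_Hausdorff_space)
  then have "openin X (space M - {x})"
    by (simp add: closedin_def X)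
  then have "space M - {x} \<in> sets M"
    by (auto simp: X(3))
  then have "space M - (space M - {x}) \<in> sets M"
    by auto
  then show ?thesis
    using assms(2) by (simp add: Diff_Diff_Int)
qed

text \<open>Finite intersections of a countable base remain countable and are closed under
  intersection, so two probability measures that agree on them are equal. This turns almost
  everywhere statements about single sets into almost everywhere statements about kernels.\<close>

lemma standard_borel_countable_generator:
  assumes "standard_borel_space M"
  obtains C where "countable C" "Int_stable C" "C \<subseteq> Pow (space M)" "space M \<in> C"
    "sets M = sigma_sets (space M) C"
proof -
  obtain X where X: "topspace X = space M" "second_countable X"
      "sets M = sigma_sets (space M) {U. openin X U}"
    using assms by (auto simp: standard_borel_space_def)
  obtain B where B: "countable B" "\<And>V. V \<in> B \<Longrightarrow> openin X V"
      "\<And>U x. openin X U \<Longrightarrow> x \<in> U \<Longrightarrow> \<exists>V\<in>B. x \<in> V \<and> V \<subseteq> U"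
    using X(2) unfolding second_countable_def by auto
  \<comment> \<open>For the empty \<open>F\<close> the set \<open>\<Inter>F\<close> is
    \<open>UNIV\<close>; cutting it down to \<open>space M\<close> puts the whole space into
    \<open>C\<close>.\<close>
  define C where "C = (\<lambda>F. space M \<inter> \<Inter>F) ` {F. finite F \<and> F \<subseteq> B}"
  have op: "openin X V" if V: "V \<in> C" for V
  proof -
    obtain F where F: "finite F" "F \<subseteq> B" "V = space M \<inter> \<Inter>F"
      using V by (auto simp: C_def)
    have "openin X (space M \<inter> \<Inter>F)"
      using F(1,2)
    proof (induction F)
      case empty
      then show ?case using openin_topspace[of X] by (simp add: X(1))
    next
      case (insert V F)
      from insert have "openin X (space M \<inter> \<Inter>F)" by simp
      moreover have "openin X V" using insert B(2) by simp
      ultimately have "openin X (V \<inter> (space M \<inter> \<Inter>F))"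
        by (rule openin_Int[rotated])
      moreover have "V \<inter> (space M \<inter> \<Inter>F) = space M \<inter> \<Inter>(insert V F)" by auto
      ultimately show ?case by simp
    qed
    then show ?thesis by (simp add: F(3))
  qed
  have "countable C"
    unfolding C_def by (intro countable_image countable_Collect_finite_subset B)
  moreover have "Int_stable C"
  proof (rule Int_stableI)
    fix V W assume "V \<in> C" "W \<in> C"
    then obtain F G where "finite F" "F \<subseteq> B" "V = space M \<inter> \<Inter>F" "finite G" "G \<subseteq> B"
        "W = space M \<inter> \<Inter>G"
      by (auto simp: C_def)
    then show "V \<inter> W \<in> C"
      unfolding C_def by (intro image_eqI[of _ _ "F \<union> G"]) auto
  qed
  moreover have C_Pow: "C \<subseteq> Pow (space M)" by (auto simp: C_def)
  moreover have "space M \<in> C"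
    unfolding C_def by (intro image_eqI[of _ _ "{}"]) auto
  moreover have "sets M = sigma_sets (space M) C"
    unfolding X(3)
  proof (intro antisym sigma_sets_mono)
    show "C \<subseteq> sigma_sets (space M) {U. openin X U}"
      using op by auto
    show "{U. openin X U} \<subseteq> sigma_sets (space M) C"
    proof safe
      fix U assume U: "openin X U"
      have B_C: "V \<in> C" if "V \<in> B" for V
      proof -
        have "V \<subseteq> space M" using B(2)[OF that] X(1) openin_subset by metis
        then show ?thesis
          unfolding C_def using that by (intro image_eqI[of _ _ "{V}"]) auto
      qed
      have "U = \<Union>{V\<in>B. V \<subseteq> U}" using B(3)[OF U] by blast
      moreover have "\<Union>{V\<in>B. V \<subseteq> U} \<in> sigma_sets (space M) C"
        using B(1) B_C
        by (intro sigma_algebra.countable_Union[OF sigma_algebra_sigma_sets[OF C_Pow]]) auto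
      ultimately show "U \<in> sigma_sets (space M) C" by simp
    qed
  qed
  ultimately show ?thesis by (rule that)
qed

text \<open>Measurability is given only for the completion. On each set of a countable generator the
  mass agrees with a Borel function off a null set. All these null sets lie in one Borel null set
  \<open>N\<close>, where the kernel is replaced by the constant probability measure
  \<open>M\<close>.\<close>

lemma kernel_borel_version:
  assumes "standard_borel_space M" "prob_space M"
    and \<nu>: "\<And>x. x \<in> space M \<Longrightarrow> prob_space (\<nu> x)" "\<And>x. x \<in> space M \<Longrightarrow> sets (\<nu> x) = sets M"
    and meas: "\<And>E. E \<in> sets M \<Longrightarrow> (\<lambda>x. measure (\<nu> x) E) \<in> borel_measurable (completion M)"
  obtains K where "K \<in> M \<rightarrow>\<^sub>M prob_algebra M" "AE x in M. K x = \<nu> x"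
proof -
  obtain C where C: "countable C" "Int_stable C" "C \<subseteq> Pow (space M)"
      "sets M = sigma_sets (space M) C"
    using standard_borel_countable_generator[OF assms(1)] by metis
  have C_sets: "E \<in> sets M" if "E \<in> C" for E using that C(4) by auto
  have "\<exists>g. g \<in> borel_measurable M \<and> (AE x in M. measure (\<nu> x) E = g x)" if "E \<in> C" for E
    using completion_ex_borel_measurable_real[OF meas[OF C_sets[OF that]]] by auto
  then obtain g where g: "\<And>E. E \<in> C \<Longrightarrow> g E \<in> borel_measurable M"
      "\<And>E. E \<in> C \<Longrightarrow> AE x in M. measure (\<nu> x) E = g E x"
    by metis
  have "AE x in M. \<forall>E\<in>C. measure (\<nu> x) E = g E x"
    using g(2) by (intro AE_ball_countable' C) auto
  then obtain N where N: "{x \<in> space M. \<not> (\<forall>E\<in>C. measure (\<nu> x) E = g E x)} \<subseteq> N" "N \<in> null_sets M"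
    by (auto elim!: AE_E simp: null_sets_def)
  have [measurable]: "N \<in> sets M" using N by auto
  define K where "K x = (if x \<in> N then M else \<nu> x)" for x
  have "K \<in> M \<rightarrow>\<^sub>M prob_algebra M"
  proof (rule measurable_prob_algebra_generated[OF C(4,2,3)])
    show "prob_space (K a)" "sets (K a) = sets M" if "a \<in> space M" for a
      using that assms(2) \<nu> by (auto simp: K_def)
    fix E assume E: "E \<in> C"
    note [measurable] = g(1)[OF E]
    have "(\<lambda>a. if a \<in> N then emeasure M E else ennreal (g E a)) \<in> borel_measurable M"
      by measurable
    then show "(\<lambda>a. emeasure (K a) E) \<in> borel_measurable M"
    proof (subst measurable_cong)
      fix a assume a: "a \<in> space M"
      interpret \<nu>: prob_space "\<nu> a" using \<nu>(1)[OF a] .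
      show "emeasure (K a) E = (if a \<in> N then emeasure M E else ennreal (g E a))"
      proof (cases "a \<in> N")
        case False
        with N(1) a have "\<forall>E\<in>C. measure (\<nu> a) E = g E a" by blast
        with False E show ?thesis by (simp add: K_def \<nu>.emeasure_eq_measure)
      qed (simp add: K_def)
    qed
  qed
  moreover have "AE x in M. K x = \<nu> x"
    using AE_not_in[OF N(2)] by eventually_elim (simp add: K_def)
  ultimately show ?thesis by (rule that)
qed

text \<open>For fixed \<open>E\<close> the hypothesis makes two functions of \<open>x\<close>
  densities of the same finite measure, so they agree almost everywhere. A countable generator
  stable under intersection leaves a single null set for all \<open>E\<close>.\<close>

lemma kernel_AE_eqI:
  assumes "standard_borel_space M" "prob_space M"
    and K: "K \<in> M \<rightarrow>\<^sub>M prob_algebra M" and L: "L \<in> M \<rightarrow>\<^sub>M prob_algebra M"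
    and eq: "\<And>A E. A \<in> sets M \<Longrightarrow> E \<in> sets M \<Longrightarrow>
      (\<integral>\<^sup>+x. emeasure (K x) E * indicator A x \<partial>M) = (\<integral>\<^sup>+x. emeasure (L x) E * indicator A x \<partial>M)"
  shows "AE x in M. K x = L x"
proof -
  interpret prob_space M by fact
  note [measurable] = measurable_prob_algebraD[OF K] measurable_prob_algebraD[OF L]
  obtain C where C: "countable C" "Int_stable C" "C \<subseteq> Pow (space M)" "space M \<in> C"
      "sets M = sigma_sets (space M) C"
    using standard_borel_countable_generator[OF assms(1)] .
  have K_prob: "prob_space (K x)" "sets (K x) = sets M" if "x \<in> space M" for x
    using measurable_space[OF K that] by (auto simp: space_prob_algebra)
  have L_prob: "sets (L x) = sets M" if "x \<in> space M" for x
    using measurable_space[OF L that] by (auto simp: space_prob_algebra)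
  have "AE x in M. emeasure (K x) E = emeasure (L x) E" if "E \<in> C" for E
  proof -
    have [measurable]: "E \<in> sets M" using that C(5) by auto
    have "(\<integral>\<^sup>+x. emeasure (K x) E \<partial>M) \<le> (\<integral>\<^sup>+x. 1 \<partial>M)"
      by (intro nn_integral_mono prob_space.emeasure_le_1 K_prob)
    then have "(\<integral>\<^sup>+x. emeasure (K x) E \<partial>M) \<noteq> \<infinity>"
      by (auto simp: emeasure_space_1 top_unique)
    moreover have "density M (\<lambda>x. emeasure (K x) E) = density M (\<lambda>x. emeasure (L x) E)"
      by (rule measure_eqI) (auto simp: emeasure_density eq)
    ultimately show ?thesis
      by (subst (asm) finite_density_unique) auto
  qed
  then have "AE x in M. \<forall>E\<in>C. emeasure (K x) E = emeasure (L x) E"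
    by (intro AE_ball_countable' C)
  with AE_space show ?thesis
  proof eventually_elim
    fix x assume x: "x \<in> space M" "\<forall>E\<in>C. emeasure (K x) E = emeasure (L x) E"
    interpret K: prob_space "K x" using K_prob x by auto
    show "K x = L x"
      using x C K_prob L_prob
      by (intro measure_eqI_generator_eq[OF C(2,3), where A="\<lambda>_. space M"]) auto
  qed
qed

section \<open>The maximal function\<close>

text \<open>A finite integral confines the value infinity to a null set, and \<open>enn2real\<close>
  changes the function only there.\<close>

lemma enn2real_integral:
  assumes [measurable]: "F \<in> borel_measurable M" and fin: "(\<integral>\<^sup>+x. F x \<partial>M) < \<infinity>"
  shows "integrable M (\<lambda>x. enn2real (F x))"
    and "(\<integral>x. enn2real (F x) \<partial>M) = enn2real (\<integral>\<^sup>+x. F x \<partial>M)"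
proof -
  have "AE x in M. F x \<noteq> \<infinity>"
    using fin by (intro nn_integral_PInf_AE) auto
  then have eq: "(\<integral>\<^sup>+x. ennreal (enn2real (F x)) \<partial>M) = (\<integral>\<^sup>+x. F x \<partial>M)"
    by (intro nn_integral_cong_AE) (auto elim!: eventually_mono simp: less_top)
  show "integrable M (\<lambda>x. enn2real (F x))"
    using fin eq by (intro integrableI_nonneg) auto
  show "(\<integral>x. enn2real (F x) \<partial>M) = enn2real (\<integral>\<^sup>+x. F x \<partial>M)"
    by (subst integral_eq_nn_integral) (auto simp: eq)
qed

text \<open>Truncated subtraction makes the value the positive part of \<open>g x\<close> plus the integral.\<close>

primrec hopf_max :: "('a \<Rightarrow> 'a measure) \<Rightarrow> ('a \<Rightarrow> real) \<Rightarrow> nat \<Rightarrow> 'a \<Rightarrow> ennreal" where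
  "hopf_max \<kappa> g 0 x = 0"
| "hopf_max \<kappa> g (Suc n) x =
     (ennreal (g x) + (\<integral>\<^sup>+y. hopf_max \<kappa> g n y \<partial>\<kappa> x)) - ennreal (- g x)"

lemma incseq_hopf_max: "incseq (\<lambda>n. hopf_max \<kappa> g n x)"
proof (rule incseq_SucI)
  show "hopf_max \<kappa> g n x \<le> hopf_max \<kappa> g (Suc n) x" for n
  proof (induction n arbitrary: x)
    case (Suc n)
    show ?case
      by (subst (1 2) hopf_max.simps(2))
         (intro ennreal_minus_mono add_mono nn_integral_mono Suc order_refl)
  qed simp
qed

text \<open>Truncation can only enlarge a difference, so adding the subtrahend back gives at least
  the minuend. The positive and negative parts of \<open>g\<close> thus stay on different sides of
  an inequality in \<open>ennreal\<close>.\<close>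

lemma le_hopf_max_Suc:
  "ennreal (g x) + (\<integral>\<^sup>+y. hopf_max \<kappa> g n y \<partial>\<kappa> x) \<le> hopf_max \<kappa> g (Suc n) x + ennreal (- g x)"
proof (cases "ennreal (- g x) \<le> ennreal (g x) + (\<integral>\<^sup>+y. hopf_max \<kappa> g n y \<partial>\<kappa> x)")
  case True
  then show ?thesis by (simp add: diff_add_cancel_ennreal)
next
  case False
  then have "ennreal (g x) + (\<integral>\<^sup>+y. hopf_max \<kappa> g n y \<partial>\<kappa> x) \<le> ennreal (- g x)" by simp
  also have "\<dots> \<le> hopf_max \<kappa> g (Suc n) x + ennreal (- g x)" by simp
  finally show ?thesis .
qed

section \<open>Fibre kernels and trees\<close>

text \<open>Borel kernels stand in for the given disintegrations: composing them with
  \<open>bind\<close> and integrating fibre integrals requires measurability in the base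
  point.\<close>

locale fibre_kernels = prob_space M for M :: "'a measure" +
  fixes T :: "'a \<Rightarrow> 'a" and K :: "nat \<Rightarrow> 'a \<Rightarrow> 'a measure"
  assumes standard_borel: "standard_borel_space M"
    and T_measurable [measurable]: "T \<in> M \<rightarrow>\<^sub>M M"
    and T_preserves: "A \<in> sets M \<Longrightarrow> measure M (T -` A \<inter> space M) = measure M A"
    and K_kernel: "K i \<in> M \<rightarrow>\<^sub>M prob_algebra M"
    and K_total: "E \<in> sets M \<Longrightarrow> (\<integral>\<^sup>+x. emeasure (K i x) E \<partial>M) = emeasure M E"
    and K_0: "x \<in> space M \<Longrightarrow> K 0 x = return M x"
    and K_fibre: "AE x in M. AE z in K i x. (T ^^ i) z = x"
begin

section \<open>Integration over fibres and composition of the kernels\<close>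

lemma K_measurable [measurable]: "K i \<in> M \<rightarrow>\<^sub>M subprob_algebra M"
  by (rule measurable_prob_algebraD[OF K_kernel])

lemma prob_space_K: "x \<in> space M \<Longrightarrow> prob_space (K i x)"
  and sets_K [simp]: "x \<in> space M \<Longrightarrow> sets (K i x) = sets M"
  and space_K [simp]: "x \<in> space M \<Longrightarrow> space (K i x) = space M"
  using measurable_space[OF K_kernel, of x i]
  by (auto simp: space_prob_algebra dest: sets_eq_imp_space_eq)

lemma nn_integral_K_measurable [measurable]:
  "\<phi> \<in> borel_measurable M \<Longrightarrow> (\<lambda>x. \<integral>\<^sup>+z. \<phi> z \<partial>K i x) \<in> borel_measurable M"
  by (rule measurable_compose[OF K_measurable nn_integral_measurable_subprob_algebra])

lemma borel_measurable_K: "\<phi> \<in> borel_measurable M \<Longrightarrow> x \<in> space M \<Longrightarrow> \<phi> \<in> borel_measurable (K i x)"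
  by (simp cong: measurable_cong_sets)

lemma nn_integral_K_total:
  assumes "\<phi> \<in> borel_measurable M"
  shows "(\<integral>\<^sup>+x. \<integral>\<^sup>+z. \<phi> z \<partial>K i x \<partial>M) = (\<integral>\<^sup>+z. \<phi> z \<partial>M)"
proof -
  have "M \<bind> K i = M"
    by (rule measure_eqI) (auto simp: sets_bind[where N=M] not_empty emeasure_bind[where N=M] K_total)
  then show ?thesis
    using nn_integral_bind[OF assms K_measurable, of i] by simp
qed

text \<open>The fibre measures of a null set average to \<open>0\<close>, so almost all of them
  vanish.\<close>

lemma AE_fibres:
  assumes "AE z in M. Q z"
  shows "AE x in M. \<forall>i. AE z in K i x. Q z"
proof -
  obtain N where N: "{z \<in> space M. \<not> Q z} \<subseteq> N" "emeasure M N = 0" "N \<in> sets M"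
    using assms by (rule AE_E)
  have "AE x in M. emeasure (K i x) N = 0" for i
    using K_total[OF N(3), of i] N by (subst nn_integral_0_iff_AE[symmetric]) auto
  then have "AE x in M. \<forall>i. emeasure (K i x) N = 0"
    by (simp add: AE_all_countable)
  with AE_space show ?thesis
    by eventually_elim (use N in \<open>auto intro!: AE_I[of _ _ N]\<close>)
qed

lemma funpow_measurable [measurable]: "T ^^ i \<in> M \<rightarrow>\<^sub>M M"
  by (rule measurable_compose_n) (rule T_measurable)

text \<open>Almost every \<open>K i x\<close> lives where \<open>(T ^^ i) z = x\<close>, so
  \<open>indicator A x\<close> can be moved under the inner integral as a function of
  \<open>z\<close>. By \<open>kernel_AE_eqI\<close> this identity determines the kernel up to a null
  set.\<close>

lemma nn_integral_K_restrict:
  assumes [measurable]: "\<phi> \<in> borel_measurable M" "A \<in> sets M"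
  shows "(\<integral>\<^sup>+x. (\<integral>\<^sup>+z. \<phi> z \<partial>K i x) * indicator A x \<partial>M) = (\<integral>\<^sup>+z. \<phi> z * indicator A ((T ^^ i) z) \<partial>M)"
proof -
  have "(\<integral>\<^sup>+x. (\<integral>\<^sup>+z. \<phi> z \<partial>K i x) * indicator A x \<partial>M)
      = (\<integral>\<^sup>+x. \<integral>\<^sup>+z. \<phi> z * indicator A ((T ^^ i) z) \<partial>K i x \<partial>M)"
  proof (rule nn_integral_cong_AE)
    show "AE x in M. (\<integral>\<^sup>+z. \<phi> z \<partial>K i x) * indicator A x
        = (\<integral>\<^sup>+z. \<phi> z * indicator A ((T ^^ i) z) \<partial>K i x)"
      using AE_space K_fibre
    proof eventually_elim
      fix x assume x: "x \<in> space M" and f: "AE z in K i x. (T ^^ i) z = x"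
      have "(\<integral>\<^sup>+z. \<phi> z * indicator A ((T ^^ i) z) \<partial>K i x) = (\<integral>\<^sup>+z. \<phi> z * indicator A x \<partial>K i x)"
        using f by (intro nn_integral_cong_AE) auto
      then show "(\<integral>\<^sup>+z. \<phi> z \<partial>K i x) * indicator A x
          = (\<integral>\<^sup>+z. \<phi> z * indicator A ((T ^^ i) z) \<partial>K i x)"
        by (simp add: nn_integral_multc borel_measurable_K x)
    qed
  qed
  also have "\<dots> = (\<integral>\<^sup>+z. \<phi> z * indicator A ((T ^^ i) z) \<partial>M)"
    by (rule nn_integral_K_total) measurable
  finally show ?thesis .
qed

text \<open>Integrated over a base set \<open>A\<close>, both kernels give the measure of the points
  of \<open>E\<close> that \<open>T ^^ Suc i\<close> maps into \<open>A\<close>. For the composed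
  kernel this comes from unfolding first the fibres of \<open>T ^^ i\<close> and then those of
  \<open>T\<close>.\<close>

lemma K_Suc: "AE x in M. K (Suc i) x = K i x \<bind> K 1"
proof (rule kernel_AE_eqI[OF standard_borel prob_space_axioms K_kernel
      measurable_bind_prob_space[OF K_kernel K_kernel]])
  fix A E assume [measurable]: "A \<in> sets M" "E \<in> sets M"
  \<comment> \<open>\<open>A'\<close> expresses the condition on the base point of
    \<open>K i\<close> as a condition on the intermediate point, which is the base point of
    \<open>K 1\<close>.\<close>
  define A' where "A' = (T ^^ i) -` A \<inter> space M"
  have [measurable]: "A' \<in> sets M" unfolding A'_def by measurable
  have "(\<integral>\<^sup>+x. emeasure (K i x \<bind> K 1) E * indicator A x \<partial>M)
      = (\<integral>\<^sup>+x. (\<integral>\<^sup>+y. emeasure (K 1 y) E \<partial>K i x) * indicator A x \<partial>M)"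
    by (intro nn_integral_cong arg_cong2[where f="(*)"] emeasure_bind[where N=M])
       (auto simp: not_empty cong: measurable_cong_sets)
  also have "\<dots> = (\<integral>\<^sup>+y. emeasure (K 1 y) E * indicator A ((T ^^ i) y) \<partial>M)"
    by (rule nn_integral_K_restrict) measurable
  also have "\<dots> = (\<integral>\<^sup>+y. (\<integral>\<^sup>+z. indicator E z \<partial>K 1 y) * indicator A' y \<partial>M)"
    by (intro nn_integral_cong) (auto simp: A'_def split: split_indicator)
  also have "\<dots> = (\<integral>\<^sup>+z. indicator E z * indicator A' ((T ^^ 1) z) \<partial>M)"
    by (rule nn_integral_K_restrict) measurable
  also have "\<dots> = (\<integral>\<^sup>+z. indicator E z * indicator A ((T ^^ Suc i) z) \<partial>M)"
    by (intro nn_integral_cong arg_cong2[where f="(*)"])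
       (auto simp: A'_def funpow_swap1 measurable_space[OF T_measurable] split: split_indicator)
  also have "\<dots> = (\<integral>\<^sup>+x. (\<integral>\<^sup>+z. indicator E z \<partial>K (Suc i) x) * indicator A x \<partial>M)"
    by (rule nn_integral_K_restrict[symmetric]) measurable
  also have "\<dots> = (\<integral>\<^sup>+x. emeasure (K (Suc i) x) E * indicator A x \<partial>M)"
    by (intro nn_integral_cong) simp
  finally show "(\<integral>\<^sup>+x. emeasure (K (Suc i) x) E * indicator A x \<partial>M)
      = (\<integral>\<^sup>+x. emeasure (K i x \<bind> K 1) E * indicator A x \<partial>M)" by simp
qed

text \<open>A point may root uncountably many trees, so exceptional points must be excluded before a
  tree is chosen. These conditions mention \<open>x\<close> alone.\<close>

definition generic :: "'a \<Rightarrow> bool" where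
  "generic x \<longleftrightarrow> x \<in> space M \<and>
     (\<forall>i. K (Suc i) x = K i x \<bind> K 1 \<and> (AE y in K i x. AE z in K 1 y. T z = y))"

lemma AE_generic: "AE x in M. generic x"
proof -
  have "AE x in M. \<forall>i. K (Suc i) x = K i x \<bind> K 1"
    using K_Suc by (simp add: AE_all_countable)
  moreover have "AE x in M. \<forall>i. AE y in K i x. AE z in K 1 y. T z = y"
    using AE_fibres[OF K_fibre[of 1]] by simp
  ultimately show ?thesis
    using AE_space by eventually_elim (simp add: generic_def)
qed

text \<open>At a generic root, level \<open>Suc i\<close> is integrated by running over the
  \<open>T\<close>-fibre of each point \<open>y\<close> of level \<open>i\<close>. There
  \<open>T z = y\<close>, so the indicator leaves the inner integral.\<close>

lemma nn_integral_K_Suc: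
  assumes x: "generic x" and [measurable]: "\<phi> \<in> borel_measurable M" "A \<in> sets M"
  shows "(\<integral>\<^sup>+z. \<phi> z * indicator A (T z) \<partial>K (Suc i) x)
    = (\<integral>\<^sup>+y. (\<integral>\<^sup>+z. \<phi> z \<partial>K 1 y) * indicator A y \<partial>K i x)"
proof -
  have x': "x \<in> space M" "K (Suc i) x = K i x \<bind> K 1"
      "AE y in K i x. AE z in K 1 y. T z = y"
    using x by (auto simp: generic_def)
  have "(\<integral>\<^sup>+z. \<phi> z * indicator A (T z) \<partial>K (Suc i) x)
      = (\<integral>\<^sup>+y. \<integral>\<^sup>+z. \<phi> z * indicator A (T z) \<partial>K 1 y \<partial>K i x)"
    unfolding x'(2) using x'(1)
    by (intro nn_integral_bind[where B=M]) (auto cong: measurable_cong_sets)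
  also have "\<dots> = (\<integral>\<^sup>+y. (\<integral>\<^sup>+z. \<phi> z \<partial>K 1 y) * indicator A y \<partial>K i x)"
  proof (rule nn_integral_cong_AE)
    show "AE y in K i x. (\<integral>\<^sup>+z. \<phi> z * indicator A (T z) \<partial>K 1 y)
        = (\<integral>\<^sup>+z. \<phi> z \<partial>K 1 y) * indicator A y"
      using x'(3) AE_space
    proof eventually_elim
      fix y assume f: "AE z in K 1 y. T z = y" and "y \<in> space (K i x)"
      then have y: "y \<in> space M" using x'(1) by simp
      have "(\<integral>\<^sup>+z. \<phi> z * indicator A (T z) \<partial>K 1 y) = (\<integral>\<^sup>+z. \<phi> z * indicator A y \<partial>K 1 y)"
        using f by (intro nn_integral_cong_AE) auto
      then show "(\<integral>\<^sup>+z. \<phi> z * indicator A (T z) \<partial>K 1 y) = (\<integral>\<^sup>+z. \<phi> z \<partial>K 1 y) * indicator A y"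
        by (simp add: nn_integral_multc borel_measurable_K y)
    qed
  qed
  finally show ?thesis .
qed

section \<open>Domination of tree sums by the maximal function\<close>

lemma hopf_max_measurable [measurable]:
  assumes [measurable]: "g \<in> borel_measurable M"
  shows "hopf_max (K 1) g n \<in> borel_measurable M"
proof (induction n)
  case (Suc n)
  note [measurable] = nn_integral_K_measurable[OF Suc, of 1]
  show ?case unfolding hopf_max.simps by measurable
qed simp

text \<open>The induction peels off the lowest level, hence the arbitrary start \<open>k\<close>.
  Coherence puts level \<open>Suc k\<close> above level \<open>k\<close>, so the bound for the upper
  levels turns into fibre integrals over \<open>E k\<close>; together with \<open>g\<close> they
  form one step of the recursion of \<open>hopf_max\<close>. The sum of negative parts on the right
  avoids subtraction in \<open>ennreal\<close>.\<close>

lemma tree_sum_le_hopf_max: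
  assumes x: "generic x" and [measurable]: "g \<in> borel_measurable M" "\<And>i. E i \<in> sets M"
    and coherent: "\<And>i. AE z in K (Suc i) x. z \<in> E (Suc i) \<longrightarrow> T z \<in> E i"
  shows "(\<Sum>i\<in>{k..<k+n}. \<integral>\<^sup>+z. ennreal (g z) * indicator (E i) z \<partial>K i x)
    \<le> (\<integral>\<^sup>+z. hopf_max (K 1) g n z * indicator (E k) z \<partial>K k x)
      + (\<Sum>i\<in>{k..<k+n}. \<integral>\<^sup>+z. ennreal (- g z) * indicator (E i) z \<partial>K i x)"
proof (induction n arbitrary: k)
  case (Suc n)
  have [simp]: "x \<in> space M" using x by (simp add: generic_def)
  let ?H = "hopf_max (K 1) g"
  let ?p = "\<lambda>i. \<integral>\<^sup>+z. ennreal (g z) * indicator (E i) z \<partial>K i x"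
  let ?q = "\<lambda>i. \<integral>\<^sup>+z. ennreal (- g z) * indicator (E i) z \<partial>K i x"
  let ?h = "\<lambda>n i. \<integral>\<^sup>+z. ?H n z * indicator (E i) z \<partial>K i x"
  have K_bm: "\<phi> \<in> borel_measurable M \<Longrightarrow> \<phi> \<in> borel_measurable (K i x)" for \<phi> :: "'a \<Rightarrow> ennreal" and i
    by (simp add: borel_measurable_K)
  have split: "{k..<k + Suc n} = insert k {Suc k..<Suc k + n}" by auto
  \<comment> \<open>The values of \<open>?H n\<close> are nonnegative, so \<open>E (Suc k)\<close>
    may be enlarged to the whole preimage of \<open>E k\<close>.\<close>
  have "?h n (Suc k) \<le> (\<integral>\<^sup>+z. ?H n z * indicator (E k) (T z) \<partial>K (Suc k) x)"
  proof (rule nn_integral_mono_AE)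
    show "AE z in K (Suc k) x. ?H n z * indicator (E (Suc k)) z \<le> ?H n z * indicator (E k) (T z)"
      using coherent[of k] by eventually_elim (auto split: split_indicator)
  qed
  also have "\<dots> = (\<integral>\<^sup>+y. (\<integral>\<^sup>+z. ?H n z \<partial>K 1 y) * indicator (E k) y \<partial>K k x)"
    by (rule nn_integral_K_Suc[OF x]) measurable
  finally have h: "?h n (Suc k) \<le> \<dots>" .
  have "?p k + ?h n (Suc k)
      \<le> (\<integral>\<^sup>+y. ennreal (g y) * indicator (E k) y + (\<integral>\<^sup>+z. ?H n z \<partial>K 1 y) * indicator (E k) y \<partial>K k x)"
    using h by (subst nn_integral_add) (auto intro!: K_bm add_mono simp del: One_nat_def)
  also have "\<dots> \<le> (\<integral>\<^sup>+y. ?H (Suc n) y * indicator (E k) y + ennreal (- g y) * indicator (E k) y \<partial>K k x)"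
    using le_hopf_max_Suc[of g _ "K 1" n]
    by (intro nn_integral_mono) (simp del: hopf_max.simps split: split_indicator)
  also have "\<dots> = ?h (Suc n) k + ?q k"
    by (intro nn_integral_add K_bm) measurable
  finally have step: "?p k + ?h n (Suc k) \<le> ?h (Suc n) k + ?q k" .
  have "sum ?p {k..<k + Suc n} \<le> ?p k + (?h n (Suc k) + sum ?q {Suc k..<Suc k + n})"
    unfolding split using Suc[of "Suc k"] by (simp add: add_left_mono del: hopf_max.simps)
  also have "\<dots> \<le> ?h (Suc n) k + ?q k + sum ?q {Suc k..<Suc k + n}"
    using step by (simp add: add.assoc[symmetric] add_right_mono del: hopf_max.simps)
  also have "\<dots> = ?h (Suc n) k + sum ?q {k..<k + Suc n}"
    unfolding split by (simp add: add.assoc del: hopf_max.simps)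
  finally show ?case .
qed simp

text \<open>At the root the kernel is a point mass, so the bound becomes a value of the maximal
  function at \<open>x\<close>. It is the same for all trees and heights, hence negligible against a
  large mass.\<close>

lemma tree_integral_le_hopf_max:
  assumes x: "generic x" and [measurable]: "g \<in> borel_measurable M" "\<And>i. E i \<in> sets M"
    and E_0: "E 0 \<subseteq> {x}"
    and coherent: "\<And>i. AE z in K (Suc i) x. z \<in> E (Suc i) \<longrightarrow> T z \<in> E i"
    and int: "\<And>i. integrable (K i x) g"
    and fin: "(SUP n. hopf_max (K 1) g n x) < \<infinity>"
  shows "(\<Sum>i<n. LINT z:E i|K i x. g z) \<le> enn2real (SUP n. hopf_max (K 1) g n x)"
proof -
  have [simp]: "x \<in> space M" using x by (simp add: generic_def)
  define p where "p i = (\<integral>\<^sup>+z. ennreal (g z) * indicator (E i) z \<partial>K i x)" for i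
  define q where "q i = (\<integral>\<^sup>+z. ennreal (- g z) * indicator (E i) z \<partial>K i x)" for i
  have int': "integrable (K i x) (\<lambda>z. indicator (E i) z * g z)" for i
    using integrable_mult_indicator[OF _ int, of "E i" i] by simp
  have ind: "ennreal (indicator A z * c) = ennreal c * indicator A z"
    "ennreal (- (indicator A z * c)) = ennreal (- c) * indicator A z" for A and z :: 'a and c
    by (auto split: split_indicator)
  have fin_pq: "p i < \<infinity>" "q i < \<infinity>" for i
    using int'[of i] unfolding real_integrable_def p_def q_def ind by (auto simp: less_top)
  have LINT: "(LINT z:E i|K i x. g z) = enn2real (p i) - enn2real (q i)" for i
    unfolding set_lebesgue_integral_def p_def q_def
    by (simp add: real_lebesgue_integral_def[OF int'] ind)
  have "(\<integral>\<^sup>+z. hopf_max (K 1) g n z * indicator (E 0) z \<partial>K 0 x) = hopf_max (K 1) g n x * indicator (E 0) x"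
    by (subst K_0) (auto intro!: nn_integral_return simp del: One_nat_def)
  also have "\<dots> \<le> hopf_max (K 1) g n x * 1"
    by (intro mult_left_mono) (auto split: split_indicator)
  also have "\<dots> \<le> (SUP n. hopf_max (K 1) g n x)" by (auto intro: SUP_upper)
  finally have "(\<Sum>i<n. p i) \<le> (SUP n. hopf_max (K 1) g n x) + (\<Sum>i<n. q i)"
    using tree_sum_le_hopf_max[OF x assms(2,3) coherent, of 0 n]
    unfolding p_def q_def by (simp add: atLeast0LessThan) (meson add_right_mono order_trans)
  \<comment> \<open>Since \<open>enn2real\<close> sends infinity to \<open>0\<close>, it is monotone
    only below a finite bound.\<close>
  moreover have "(SUP n. hopf_max (K 1) g n x) + (\<Sum>i<n. q i) < \<infinity>"
    using fin fin_pq by auto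
  ultimately have "enn2real (\<Sum>i<n. p i) \<le> enn2real ((SUP n. hopf_max (K 1) g n x) + (\<Sum>i<n. q i))"
    by (intro enn2real_mono) auto
  also have "\<dots> = enn2real (SUP n. hopf_max (K 1) g n x) + enn2real (\<Sum>i<n. q i)"
    using fin fin_pq by (intro enn2real_plus) auto
  finally have "(\<Sum>i<n. enn2real (p i)) \<le> enn2real (SUP n. hopf_max (K 1) g n x) + (\<Sum>i<n. enn2real (q i))"
    using fin_pq by (simp add: enn2real_sum)
  then show ?thesis
    by (simp add: LINT sum_subtractf)
qed

subsection \<open>The maximal inequality\<close>

text \<open>Integration over the fibres of \<open>T\<close> preserves integrals over
  \<open>M\<close>, so each step of the recursion adds at most the integral of the positive part of
  \<open>g\<close>.\<close>

lemma hopf_max_integral_finite: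
  assumes [measurable]: "g \<in> borel_measurable M" and int: "integrable M g"
  shows "(\<integral>\<^sup>+x. hopf_max (K 1) g n x \<partial>M) < \<infinity>"
proof (induction n)
  case (Suc n)
  have "(\<integral>\<^sup>+x. hopf_max (K 1) g (Suc n) x \<partial>M)
      \<le> (\<integral>\<^sup>+x. ennreal (g x) + (\<integral>\<^sup>+y. hopf_max (K 1) g n y \<partial>K 1 x) \<partial>M)"
    by (intro nn_integral_mono) (simp add: diff_le_self_ennreal del: One_nat_def)
  also have "\<dots> = (\<integral>\<^sup>+x. ennreal (g x) \<partial>M) + (\<integral>\<^sup>+x. \<integral>\<^sup>+y. hopf_max (K 1) g n y \<partial>K 1 x \<partial>M)"
    by (rule nn_integral_add) measurable
  also have "\<dots> = (\<integral>\<^sup>+x. ennreal (g x) \<partial>M) + (\<integral>\<^sup>+x. hopf_max (K 1) g n x \<partial>M)"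
    by (subst nn_integral_K_total) (simp_all del: One_nat_def)
  also have "\<dots> < \<infinity>"
    using Suc int by (simp add: real_integrable_def less_top)
  finally show ?case .
qed simp

text \<open>If the value is finite at \<open>x\<close> then it is finite almost everywhere on the fibre over \<open>x\<close>, so
  the complement of the set of infinite values contains its own preimage up to a null set.\<close>

lemma hopf_max_infinite_invariant:
  fixes g
  assumes [measurable]: "g \<in> borel_measurable M"
  defines "D \<equiv> {x \<in> space M. (SUP n. hopf_max (K 1) g n x) = \<infinity>}"
  shows "D \<in> invariant_sets M T"
proof -
  have [measurable]: "D \<in> sets M" unfolding D_def by measurable
  have fibre: "emeasure (K 1 x) D = 0" if x: "x \<in> space M - D" for x
  proof -
    let ?S = "\<lambda>y. SUP n. hopf_max (K 1) g n y"
    have [simp]: "x \<in> space M" using x by simp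
    have "?S x \<noteq> \<infinity>" using x unfolding D_def by blast
    then have fin: "?S x < \<infinity>" by (simp only: less_top infinity_ennreal_def)
    have "(\<integral>\<^sup>+y. ?S y \<partial>K 1 x) = (SUP n. \<integral>\<^sup>+y. hopf_max (K 1) g n y \<partial>K 1 x)"
      using incseq_hopf_max[of "K 1" g]
      by (intro nn_integral_monotone_convergence_SUP)
         (auto simp: incseq_def le_fun_def borel_measurable_K simp del: One_nat_def)
    also have "\<dots> \<le> ?S x + ennreal (- g x)"
    proof (rule SUP_least)
      fix n
      have "(\<integral>\<^sup>+y. hopf_max (K 1) g n y \<partial>K 1 x) \<le> ennreal (g x) + (\<integral>\<^sup>+y. hopf_max (K 1) g n y \<partial>K 1 x)"
        by simp
      also have "\<dots> \<le> hopf_max (K 1) g (Suc n) x + ennreal (- g x)" by (rule le_hopf_max_Suc)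
      also have "\<dots> \<le> ?S x + ennreal (- g x)" by (intro add_right_mono SUP_upper) simp
      finally show "(\<integral>\<^sup>+y. hopf_max (K 1) g n y \<partial>K 1 x) \<le> ?S x + ennreal (- g x)" .
    qed
    also have "\<dots> < \<infinity>" using fin by simp
    finally have "AE y in K 1 x. ?S y \<noteq> \<infinity>"
      by (intro nn_integral_PInf_AE) (auto intro!: borel_measurable_K simp del: One_nat_def)
    then have "AE y in K 1 x. y \<notin> D"
      by eventually_elim (simp add: D_def)
    then show ?thesis
      by (subst (asm) AE_iff_measurable[of D]) (use sets.sets_into_space[OF \<open>D \<in> sets M\<close>] in auto)
  qed
  define D' where "D' = T -` D \<inter> space M"
  have [measurable]: "D' \<in> sets M" unfolding D'_def by measurable
  have "emeasure M (D - D') = (\<integral>\<^sup>+z. indicator (D - D') z \<partial>M)"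
    by simp
  \<comment> \<open>Up to this rewriting \<open>D - D'\<close> is the part of \<open>D\<close> that
    lies over the complement of \<open>D\<close>, where every fibre gives \<open>D\<close> measure
    \<open>0\<close>.\<close>
  also have "\<dots> = (\<integral>\<^sup>+z. indicator D z * indicator (space M - D) ((T ^^ 1) z) \<partial>M)"
    using measurable_space[OF T_measurable]
    by (intro nn_integral_cong) (auto simp: D'_def D_def split: split_indicator)
  also have "\<dots> = (\<integral>\<^sup>+x. (\<integral>\<^sup>+z. indicator D z \<partial>K 1 x) * indicator (space M - D) x \<partial>M)"
    by (rule nn_integral_K_restrict[symmetric]) measurable
  also have "\<dots> = (\<integral>\<^sup>+x. 0 \<partial>M)"
    by (intro nn_integral_cong) (auto simp: fibre split: split_indicator simp del: One_nat_def)
  finally have null: "measure M (D - D') = 0" by (simp add: emeasure_eq_measure)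
  \<comment> \<open>As \<open>T\<close> preserves the measure, \<open>D\<close> and its preimage
    have equal measure, so one difference being null forces the other to be null.\<close>
  have "measure M D' = measure M D" unfolding D'_def by (rule T_preserves) simp
  moreover have "measure M (D' \<inter> D) + measure M (D' - D) = measure M D'"
    using finite_measure_Union[of "D' \<inter> D" "D' - D"] by (simp add: Int_Diff_Un Int_Diff_disjoint)
  moreover have "measure M (D \<inter> D') + measure M (D - D') = measure M D"
    using finite_measure_Union[of "D \<inter> D'" "D - D'"] by (simp add: Int_Diff_Un Int_Diff_disjoint)
  ultimately have "measure M (D' - D) = 0" using null by (simp add: Int_commute)
  then have "measure M (sym_diff D D') = 0"
    using null finite_measure_Union[of "D - D'" "D' - D"] by auto
  then show ?thesis by (simp add: invariant_sets_def D'_def)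
qed

text \<open>Garsia's argument for Hopf's maximal inequality: on the invariant set \<open>D\<close> the increments
  \<open>H (n + 1) - P (H n)\<close>, where \<open>P\<close> integrates over the fibres of \<open>T\<close>, have nonnegative integral,
  and they are eventually equal to \<open>g\<close>.\<close>

lemma hopf_max_infinite_integral_nonneg:
  fixes g
  assumes [measurable]: "g \<in> borel_measurable M" and int: "integrable M g"
  defines "D \<equiv> {x \<in> space M. (SUP n. hopf_max (K 1) g n x) = \<infinity>}"
  shows "0 \<le> (LINT x:D|M. g x)"
proof -
  have D: "D \<in> invariant_sets M T"
    unfolding D_def by (rule hopf_max_infinite_invariant) simp
  then have [measurable]: "D \<in> sets M" by (simp add: invariant_sets_def)
  have "AE z in M. z \<notin> sym_diff D (T -` D \<inter> space M)"
    using D by (intro AE_not_in) (auto simp: invariant_sets_def null_sets_def emeasure_eq_measure)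
  then have D_T: "AE z in M. z \<in> D \<longleftrightarrow> T z \<in> D"
    using AE_space by eventually_elim auto
  let ?H = "hopf_max (K 1) g"
  define A where "A n x = (\<integral>\<^sup>+y. ?H n y \<partial>K 1 x)" for n x
  have [measurable]: "A n \<in> borel_measurable M" for n
    unfolding A_def by measurable
  have H_Suc: "?H (Suc n) x = (ennreal (g x) + A n x) - ennreal (- g x)" for n x
    by (simp add: A_def)
  have A_total: "(\<integral>\<^sup>+x. A n x \<partial>M) = (\<integral>\<^sup>+x. ?H n x \<partial>M)" for n
    unfolding A_def by (rule nn_integral_K_total) (simp del: One_nat_def)
  \<comment> \<open>Invariance of \<open>D\<close> up to a null set lets the fibre integral preserve
    the integral over \<open>D\<close>, not only the one over the whole space.\<close>
  have A_D: "(\<integral>\<^sup>+x. A n x * indicator D x \<partial>M) = (\<integral>\<^sup>+x. ?H n x * indicator D x \<partial>M)" for n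
  proof -
    have "(\<integral>\<^sup>+x. A n x * indicator D x \<partial>M) = (\<integral>\<^sup>+x. ?H n x * indicator D ((T ^^ 1) x) \<partial>M)"
      unfolding A_def by (rule nn_integral_K_restrict) measurable
    also have "\<dots> = (\<integral>\<^sup>+x. ?H n x * indicator D x \<partial>M)"
      using D_T by (intro nn_integral_cong_AE) (auto elim!: eventually_mono split: split_indicator)
    finally show ?thesis .
  qed
  have fin: "(\<integral>\<^sup>+x. ?H n x * indicator D x \<partial>M) < \<infinity>" for n
  proof -
    have "(\<integral>\<^sup>+x. ?H n x * indicator D x \<partial>M) \<le> (\<integral>\<^sup>+x. ?H n x \<partial>M)"
      by (intro nn_integral_mono) (auto split: split_indicator)
    also have "\<dots> < \<infinity>" by (rule hopf_max_integral_finite) (use int in auto)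
    finally show ?thesis .
  qed
  define u where "u n x = enn2real (?H (Suc n) x * indicator D x) - enn2real (A n x * indicator D x)" for n x
  \<comment> \<open>By \<open>A_D\<close> the integral of \<open>u n\<close> is the difference of
    the integrals of \<open>?H (Suc n)\<close> and \<open>?H n\<close> over \<open>D\<close>, and
    the iterates increase.\<close>
  have u_nonneg: "0 \<le> (\<integral>x. u n x \<partial>M)" for n
  proof -
    have "(\<integral>x. u n x \<partial>M) = enn2real (\<integral>\<^sup>+x. ?H (Suc n) x * indicator D x \<partial>M)
        - enn2real (\<integral>\<^sup>+x. ?H n x * indicator D x \<partial>M)"
    proof -
      have H: "(\<lambda>x. ?H (Suc n) x * indicator D x) \<in> borel_measurable M" by measurable
      have A: "(\<lambda>x. A n x * indicator D x) \<in> borel_measurable M" by measurable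
      show ?thesis
        unfolding u_def
        using enn2real_integral[OF H fin] enn2real_integral[OF A, unfolded A_D, OF fin]
        by (simp del: hopf_max.simps One_nat_def)
    qed
    moreover have "(\<integral>\<^sup>+x. ?H n x * indicator D x \<partial>M) \<le> (\<integral>\<^sup>+x. ?H (Suc n) x * indicator D x \<partial>M)"
      using incseq_SucD[OF incseq_hopf_max] by (intro nn_integral_mono mult_right_mono) auto
    ultimately show ?thesis
      using enn2real_mono fin by (simp del: hopf_max.simps One_nat_def)
  qed
  have "AE x in M. A n x \<noteq> \<infinity>" for n
    using hopf_max_integral_finite[OF _ int, of n]
    by (intro nn_integral_PInf_AE) (auto simp: A_total simp del: One_nat_def)
  then have A_fin: "AE x in M. \<forall>n. A n x \<noteq> \<infinity>"
    by (simp add: AE_all_countable)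
  \<comment> \<open>With \<open>a = A n x\<close>, on \<open>D\<close> the value is
    \<open>max 0 (g x + a) - a = max (- a) (g x)\<close>. As \<open>- a \<le> 0\<close>, it is
    dominated in absolute value by \<open>g x\<close>.\<close>
  have u_eq: "u n x = (max (- enn2real (A n x)) (g x)) * indicator D x" if A_n: "A n x \<noteq> \<infinity>" for n x
  proof -
    obtain a where a: "A n x = ennreal a" "0 \<le> a" using A_n by (cases "A n x") auto
    have "?H (Suc n) x = ennreal (max 0 (g x + a))"
      unfolding H_Suc a
      by (cases "0 \<le> g x")
         (auto simp: ennreal_neg a ennreal_plus[symmetric] ennreal_minus max_def simp del: ennreal_plus
           intro!: ennreal_neg)
    then show ?thesis
      using a by (simp add: u_def max_def del: hopf_max.simps split: split_indicator)
  qed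
  have "(\<lambda>n. \<integral>x. u n x \<partial>M) \<longlonglongrightarrow> (\<integral>x. indicator D x * g x \<partial>M)"
  proof (rule integral_dominated_convergence)
    show "integrable M (\<lambda>x. \<bar>g x\<bar>)" using int by simp
    show "AE x in M. norm (u n x) \<le> \<bar>g x\<bar>" for n
      using A_fin
    proof eventually_elim
      fix x assume "\<forall>n. A n x \<noteq> \<infinity>"
      then have "u n x = (max (- enn2real (A n x)) (g x)) * indicator D x" by (intro u_eq) auto
      then show "norm (u n x) \<le> \<bar>g x\<bar>"
        using enn2real_nonneg[of "A n x"] by (auto split: split_indicator simp: max_def)
    qed
    show "AE x in M. (\<lambda>n. u n x) \<longlonglongrightarrow> indicator D x * g x"
      using A_fin
    proof eventually_elim
      fix x assume A_fin: "\<forall>n. A n x \<noteq> \<infinity>"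
      show "(\<lambda>n. u n x) \<longlonglongrightarrow> indicator D x * g x"
      proof (cases "x \<in> D")
        case False
        then show ?thesis by (simp add: u_def)
      next
        case True
        then have S: "(SUP n. ?H n x) = \<infinity>" unfolding D_def by blast
        have "0 < (SUP n. ?H n x)" unfolding S by simp
        \<comment> \<open>From a positive iterate on, all iterates are positive. The maximum with
          \<open>0\<close> is then attained by \<open>g x + A n x\<close>, and the increment is
          exactly \<open>g x\<close>.\<close>
        then obtain m where m: "0 < ?H m x" unfolding less_SUP_iff by auto
        have "u n x = indicator D x * g x" if "n \<ge> m" for n
        proof -
          have "0 < ?H (Suc n) x"
            using m incseqD[OF incseq_hopf_max, of m "Suc n" "K 1" g x] that
            by (auto simp del: hopf_max.simps One_nat_def intro: less_le_trans)
          moreover have "A n x = ennreal (enn2real (A n x))" using A_fin by (simp add: less_top)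
          ultimately have "0 < (ennreal (g x) + ennreal (enn2real (A n x))) - ennreal (- g x)"
            by (simp only: H_Suc)
          then have "- enn2real (A n x) < g x"
            using enn2real_nonneg[of "A n x"]
            by (cases "0 \<le> g x")
               (auto simp: ennreal_neg ennreal_minus ennreal_plus[symmetric] simp del: ennreal_plus)
          with u_eq[of n x] A_fin True show ?thesis by simp
        qed
        then show ?thesis
          by (intro tendsto_eventually eventually_sequentiallyI[of m])
      qed
    qed
  qed (auto simp: u_def simp del: hopf_max.simps One_nat_def)
  then show ?thesis
    using u_nonneg unfolding set_lebesgue_integral_def
    by (intro LIMSEQ_le_const[of _ _ 0]) auto
qed

text \<open>The maximal inequality is applied to \<open>g - \<epsilon>\<close>; the vanishing mean
  on invariant sets leaves only \<open>- \<epsilon>\<close> times a measure.\<close>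

lemma hopf_max_finite:
  assumes [measurable]: "g \<in> borel_measurable M" and int: "integrable M g" and "0 < \<epsilon>"
    and mean: "\<And>D. D \<in> invariant_sets M T \<Longrightarrow> (LINT x:D|M. g x) = 0"
  shows "AE x in M. (SUP n. hopf_max (K 1) (\<lambda>x. g x - \<epsilon>) n x) < \<infinity>"
proof -
  define D where "D = {x \<in> space M. (SUP n. hopf_max (K 1) (\<lambda>x. g x - \<epsilon>) n x) = \<infinity>}"
  have D: "D \<in> invariant_sets M T"
    unfolding D_def by (rule hopf_max_infinite_invariant) simp
  then have [measurable]: "D \<in> sets M" by (simp add: invariant_sets_def)
  have "0 \<le> (LINT x:D|M. g x - \<epsilon>)"
    unfolding D_def by (rule hopf_max_infinite_integral_nonneg) (use int in auto)
  also have "\<dots> = (LINT x:D|M. g x) - (LINT x:D|M. \<epsilon>)"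
    using int by (intro set_integral_diff) (auto simp del: integrable_mult_left_iff real_scaleR_def simp: set_integrable_def intro!: integrable_mult_indicator)
  also have "\<dots> = - \<epsilon> * measure M D"
    using mean[OF D] by (simp add: set_lebesgue_integral_def)
  finally have "measure M D = 0"
    using \<open>0 < \<epsilon>\<close> measure_nonneg[of M D] by (simp add: mult_le_0_iff)
  then have "AE x in M. x \<notin> D"
    by (intro AE_not_in) (simp add: null_sets_def emeasure_eq_measure)
  with AE_space show ?thesis
    by eventually_elim (simp add: D_def less_top[symmetric] del: SUP_eq_top_iff One_nat_def)
qed

end

section \<open>Convergence along trees\<close>

text \<open>The completion contains every subset of the space that agrees almost everywhere with one
  of its sets, and the preimages under \<open>f\<close> and \<open>g\<close> agree in this
  sense.\<close>

lemma borel_measurable_completion_AE: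
  assumes g: "g \<in> measurable M N" and eq: "AE x in M. f x = g x" and f: "f \<in> space M \<rightarrow> space N"
  shows "f \<in> measurable (completion M) N"
proof (rule measurableI)
  fix A assume A: "A \<in> sets N"
  have gA: "g -` A \<inter> space M \<in> sets (completion M)"
    using measurable_sets[OF g A] by (rule sets_completionI_sets)
  have "AE x in completion M. x \<in> g -` A \<inter> space M \<longleftrightarrow> x \<in> f -` A \<inter> space M"
    using eq unfolding AE_completion_iff by eventually_elim auto
  from completion.in_sets_AE[OF this gA]
  show "f -` A \<inter> space (completion M) \<in> sets (completion M)"
    by simp
qed (use f in auto)

text \<open>Serves to exchange \<open>f\<close> for a Borel version, both over \<open>M\<close> and
  over each fibre measure.\<close>

lemma set_integral_completion_AE:
  fixes f g :: "'a \<Rightarrow> real"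
  assumes [measurable]: "g \<in> borel_measurable M" "A \<in> sets M" and g: "integrable M g"
    and eq: "AE x in M. f x = g x"
  shows "set_integrable (completion M) A f"
    and "(LINT x:A|completion M. f x) = (LINT x:A|M. g x)"
proof -
  have f: "f \<in> borel_measurable (completion M)"
    using eq by (intro borel_measurable_completion_AE[where g=g]) auto
  have A: "A \<in> sets (completion M)" by simp
  have g_bm: "(\<lambda>x. indicator A x * g x) \<in> borel_measurable M" by measurable
  have gA: "integrable M (\<lambda>x. indicator A x * g x)"
    using integrable_mult_indicator[OF _ g, of A] by simp
  have eqA: "AE x in completion M. indicator A x * f x = indicator A x * g x"
    using eq unfolding AE_completion_iff by eventually_elim simp
  have fA_bm: "(\<lambda>x. indicator A x * f x) \<in> borel_measurable (completion M)"
    using f A by measurable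
  note gA_bm = measurable_completion[OF g_bm]
  show "set_integrable (completion M) A f"
    unfolding set_integrable_def real_scaleR_def
    using gA integrable_cong_AE[OF fA_bm gA_bm eqA] by (simp add: integrable_completion[OF g_bm])
  show "(LINT x:A|completion M. f x) = (LINT x:A|M. g x)"
    unfolding set_lebesgue_integral_def real_scaleR_def
    using integral_cong_AE[OF fA_bm gA_bm eqA] by (simp add: integral_completion[OF g_bm])
qed

text \<open>Each sublevel set of \<open>L\<close> at a rational is invariant up to a null set. Off
  countably many null sets \<open>L x\<close> and \<open>L (T x)\<close> lie below the same
  rationals, hence are equal.\<close>

lemma AE_invariant_function:
  fixes L :: "'a \<Rightarrow> real"
  assumes "finite_measure M" and T: "T \<in> M \<rightarrow>\<^sub>M M" and L: "L \<in> borel_measurable (invariant_algebra M T)"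
  shows "AE x in M. L (T x) = L x"
proof -
  interpret finite_measure M by fact
  have "AE x in M. L x < of_rat q \<longleftrightarrow> L (T x) < of_rat q" for q
  proof -
    let ?A = "{x \<in> space M. L x < of_rat q}"
    have "{x \<in> space (invariant_algebra M T). L x < of_rat q} \<in> sets (invariant_algebra M T)"
      using L by measurable
    then have "?A \<in> invariant_sets M T"
      by (simp add: sets_invariant_algebra[OF assms(1) T]) (simp add: invariant_algebra_def space_measure_of_conv)
    then have "AE x in M. x \<notin> sym_diff ?A (T -` ?A \<inter> space M)"
      using T by (intro AE_not_in) (auto simp: invariant_sets_def null_sets_def emeasure_eq_measure)
    with AE_space show ?thesis
      by eventually_elim (use measurable_space[OF T] in auto)
  qed
  then have "AE x in M. \<forall>q::rat. L x < of_rat q \<longleftrightarrow> L (T x) < of_rat q"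
    by (simp add: AE_all_countable)
  then show ?thesis
  proof eventually_elim
    fix x assume *: "\<forall>q::rat. L x < of_rat q \<longleftrightarrow> L (T x) < of_rat q"
    show "L (T x) = L x"
    proof (rule linorder_cases)
      assume "L (T x) < L x"
      then show ?thesis using of_rat_dense * by (metis less_asym)
    next
      assume "L x < L (T x)"
      then show ?thesis using of_rat_dense * by (metis less_asym)
    qed
  qed
qed

section \<open>Two-sided bounds for the tree sums at a fixed root\<close>

context fibre_kernels begin

text \<open>Infinite sequences keep length conditions out of the estimates; levels may be empty, so
  finite trees are included through truncation.\<close>

definition coherent_family :: "'a \<Rightarrow> (nat \<Rightarrow> 'a set) \<Rightarrow> bool" where
  "coherent_family x E \<longleftrightarrow> (\<forall>i. E i \<in> sets M) \<and> E 0 \<subseteq> {x} \<and>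
     (\<forall>i. AE z in K (Suc i) x. z \<in> E (Suc i) \<longrightarrow> T z \<in> E i)"

text \<open>The fibre integrals of the absolute value of \<open>g\<close> have a finite average, so
  almost all are finite.\<close>

lemma AE_integrable_K:
  assumes [measurable]: "g \<in> borel_measurable M" and int: "integrable M (g :: 'a \<Rightarrow> real)"
  shows "AE x in M. \<forall>i. integrable (K i x) g"
proof -
  have "AE x in M. (\<integral>\<^sup>+z. ennreal (norm (g z)) \<partial>K i x) \<noteq> \<infinity>" for i
  proof (rule nn_integral_PInf_AE)
    show "(\<integral>\<^sup>+x. \<integral>\<^sup>+z. ennreal (norm (g z)) \<partial>K i x \<partial>M) \<noteq> \<infinity>"
      using int by (subst nn_integral_K_total) (auto simp: integrable_iff_bounded)
  qed measurable
  then have "AE x in M. \<forall>i. (\<integral>\<^sup>+z. ennreal (norm (g z)) \<partial>K i x) \<noteq> \<infinity>"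
    by (simp add: AE_all_countable)
  with AE_space show ?thesis
    by eventually_elim (auto simp: integrable_iff_bounded less_top cong: measurable_cong_sets)
qed

text \<open>Invariance iterates to \<open>L ((T ^^ i) z) = L z\<close> and passes to the fibres;
  over \<open>x\<close> the left side is \<open>L x\<close>.\<close>

lemma AE_invariant_const_on_fibres:
  assumes inv: "AE z in M. L (T z) = L z"
  shows "AE x in M. \<forall>i. AE z in K i x. L z = L x"
proof -
  have "AE z in M. L ((T ^^ i) z) = L z" for i
  proof (induction i)
    case (Suc i)
    \<comment> \<open>Because \<open>T\<close> preserves the measure, a property that holds almost
      everywhere still does after replacing \<open>z\<close> by \<open>T z\<close>.\<close>
    have T_distr: "distr M M T = M"
    proof (rule measure_eqI)
      fix A assume "A \<in> sets (distr M M T)"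
      then show "emeasure (distr M M T) A = emeasure M A"
        using T_preserves by (simp add: emeasure_distr emeasure_eq_measure)
    qed simp
    then have "AE z in distr M M T. L ((T ^^ i) z) = L z"
      by (subst T_distr) (rule Suc)
    then have "AE z in M. L ((T ^^ i) (T z)) = L (T z)"
      by (rule AE_distrD[rotated]) simp
    then show ?case
      using inv by eventually_elim (simp add: funpow_swap1)
  qed simp
  then have "AE z in M. \<forall>i. L ((T ^^ i) z) = L z"
    by (simp add: AE_all_countable)
  then have "AE x in M. \<forall>i. AE z in K i x. \<forall>i. L ((T ^^ i) z) = L z"
    by (rule AE_fibres)
  moreover have "AE x in M. \<forall>i. AE z in K i x. (T ^^ i) z = x"
    using K_fibre by (simp add: AE_all_countable)
  ultimately show ?thesis
  proof eventually_elim
    fix x assume "\<forall>i. AE z in K i x. \<forall>i. L ((T ^^ i) z) = L z" "\<forall>i. AE z in K i x. (T ^^ i) z = x"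
    then have "AE z in K i x. (\<forall>i. L ((T ^^ i) z) = L z) \<and> (T ^^ i) z = x" for i by auto
    then have "AE z in K i x. L z = L x" for i
      by (rule eventually_mono) metis
    then show "\<forall>i. AE z in K i x. L z = L x" by blast
  qed
qed

text \<open>Over \<open>x\<close> the function \<open>L\<close> is the constant \<open>L x\<close>,
  and a constant contributes a multiple of the mass. What remains is a tree sum of
  \<open>g - \<epsilon>\<close>, bounded by the maximal function at \<open>x\<close>, which supplies
  \<open>C\<close>.\<close>

lemma tree_upper_bound:
  assumes [measurable]: "f \<in> borel_measurable M" "L \<in> borel_measurable M"
    and f: "integrable M f" and L: "integrable M L" and inv: "AE z in M. L (T z) = L z"
    and mean: "\<And>D. D \<in> invariant_sets M T \<Longrightarrow> (LINT x:D|M. f x) = (LINT x:D|M. L x)"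
    and "0 < \<epsilon>"
  shows "AE x in M. \<exists>C. \<forall>E n. coherent_family x E \<longrightarrow>
    (\<Sum>i<n. LINT z:E i|K i x. f z) \<le> C + (L x + \<epsilon>) * (\<Sum>i<n. measure (K i x) (E i))"
proof -
  have set_int: "set_integrable N A h" if "integrable N h" "A \<in> sets N" for N :: "'a measure" and A and h :: "'a \<Rightarrow> real"
    unfolding set_integrable_def by (rule integrable_mult_indicator) fact+
  define g where "g x = f x - L x" for x
  have [measurable]: "g \<in> borel_measurable M" unfolding g_def by measurable
  have g: "integrable M g" using f L unfolding g_def by auto
  have "AE x in M. (SUP n. hopf_max (K 1) (\<lambda>x. g x - \<epsilon>) n x) < \<infinity>"
  proof (rule hopf_max_finite[OF _ g \<open>0 < \<epsilon>\<close>])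
    fix D assume D: "D \<in> invariant_sets M T"
    then have "D \<in> sets M" by (simp add: invariant_sets_def)
    then show "(LINT x:D|M. g x) = 0"
      unfolding g_def using set_int[OF f] set_int[OF L] by (simp add: set_integral_diff mean[OF D])
  qed simp
  moreover have "AE x in M. \<forall>i. integrable (K i x) f"
    by (rule AE_integrable_K) (use f in auto)
  moreover have "AE x in M. \<forall>i. integrable (K i x) g"
    by (rule AE_integrable_K) (use g in auto)
  ultimately show ?thesis
    using AE_generic AE_invariant_const_on_fibres[OF inv]
  proof eventually_elim
    fix x
    let ?S = "SUP n. hopf_max (K 1) (\<lambda>x. g x - \<epsilon>) n x"
    assume fin: "?S < \<infinity>" and int_f: "\<forall>i. integrable (K i x) f" and int_g: "\<forall>i. integrable (K i x) g"
      and x: "generic x" and L_x: "\<forall>i. AE z in K i x. L z = L x"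
    have [simp]: "x \<in> space M" using x by (simp add: generic_def)
    show "\<exists>C. \<forall>E n. coherent_family x E \<longrightarrow>
      (\<Sum>i<n. LINT z:E i|K i x. f z) \<le> C + (L x + \<epsilon>) * (\<Sum>i<n. measure (K i x) (E i))"
    proof (intro exI allI impI)
      fix E n assume E: "coherent_family x E"
      then have [measurable]: "E i \<in> sets M" for i by (simp add: coherent_family_def)
      have "(LINT z:E i|K i x. f z) = (LINT z:E i|K i x. g z - \<epsilon>) + (L x + \<epsilon>) * measure (K i x) (E i)" for i
      proof -
        interpret Ki: prob_space "K i x" by (rule prob_space_K) simp
        have "(LINT z:E i|K i x. g z - \<epsilon>) = (LINT z:E i|K i x. f z - (L x + \<epsilon>))"
        proof (rule set_lebesgue_integral_cong_AE)
          show "AE z in K i x. z \<in> E i \<longrightarrow> g z - \<epsilon> = f z - (L x + \<epsilon>)"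
            using L_x[rule_format, of i] by eventually_elim (simp add: g_def)
        qed (simp_all cong: measurable_cong_sets)
        also have "\<dots> = (LINT z:E i|K i x. f z) - (LINT z:E i|K i x. L x + \<epsilon>)"
          using int_f by (intro set_integral_diff set_int) auto
        also have "(LINT z:E i|K i x. L x + \<epsilon>) = (L x + \<epsilon>) * measure (K i x) (E i)"
          by (simp add: set_lebesgue_integral_def)
        finally show ?thesis by simp
      qed
      then have "(\<Sum>i<n. LINT z:E i|K i x. f z)
          = (\<Sum>i<n. LINT z:E i|K i x. g z - \<epsilon>) + (L x + \<epsilon>) * (\<Sum>i<n. measure (K i x) (E i))"
        by (simp add: sum.distrib sum_distrib_left)
      moreover have "(\<Sum>i<n. LINT z:E i|K i x. g z - \<epsilon>) \<le> enn2real ?S"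
      proof (rule tree_integral_le_hopf_max[OF x])
        show "integrable (K i x) (\<lambda>z. g z - \<epsilon>)" for i
        proof -
          interpret Ki: prob_space "K i x" by (rule prob_space_K) simp
          show ?thesis using int_g by auto
        qed
      qed (use E fin in \<open>auto simp: coherent_family_def\<close>)
      ultimately show "(\<Sum>i<n. LINT z:E i|K i x. f z)
          \<le> enn2real ?S + (L x + \<epsilon>) * (\<Sum>i<n. measure (K i x) (E i))"
        by simp
    qed
  qed
qed

text \<open>The upper bound is applied to \<open>f\<close> and to \<open>- f\<close>. Only the
  countably many values \<open>inverse (real (Suc k))\<close> are used, so that one null set serves
  every \<open>\<epsilon>\<close>.\<close>

lemma tree_two_sided_bound:
  assumes [measurable]: "f \<in> borel_measurable M" "L \<in> borel_measurable M"
    and f: "integrable M f" and L: "integrable M L" and inv: "AE z in M. L (T z) = L z"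
    and mean: "\<And>D. D \<in> invariant_sets M T \<Longrightarrow> (LINT x:D|M. f x) = (LINT x:D|M. L x)"
  shows "AE x in M. \<forall>\<epsilon>>0. \<exists>C. \<forall>E n. coherent_family x E \<longrightarrow>
    \<bar>(\<Sum>i<n. LINT z:E i|K i x. f z) - L x * (\<Sum>i<n. measure (K i x) (E i))\<bar>
      \<le> C + \<epsilon> * (\<Sum>i<n. measure (K i x) (E i))"
proof -
  have "AE x in M. \<forall>k. \<exists>C. \<forall>E n. coherent_family x E \<longrightarrow>
    (\<Sum>i<n. LINT z:E i|K i x. f z) \<le> C + (L x + inverse (real (Suc k))) * (\<Sum>i<n. measure (K i x) (E i))"
    unfolding AE_all_countable
    by (intro allI tree_upper_bound) (use f L inv mean in auto)
  moreover have "AE x in M. \<forall>k. \<exists>C. \<forall>E n. coherent_family x E \<longrightarrow>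
    (\<Sum>i<n. LINT z:E i|K i x. - f z) \<le> C + (- L x + inverse (real (Suc k))) * (\<Sum>i<n. measure (K i x) (E i))"
    unfolding AE_all_countable
    by (intro allI tree_upper_bound)
       (use f L inv mean in \<open>auto simp: set_lebesgue_integral_def\<close>)
  ultimately show ?thesis
  proof (eventually_elim, intro allI impI)
    fix x and \<epsilon> :: real
    let ?f = "\<lambda>E n. \<Sum>i<n. LINT z:E i|K i x. f z" and ?m = "\<lambda>E n. \<Sum>i<n. measure (K i x) (E i)"
    assume up: "\<forall>k. \<exists>C. \<forall>E n. coherent_family x E \<longrightarrow> ?f E n \<le> C + (L x + inverse (real (Suc k))) * ?m E n"
      and low: "\<forall>k. \<exists>C. \<forall>E n. coherent_family x E \<longrightarrow>
        (\<Sum>i<n. LINT z:E i|K i x. - f z) \<le> C + (- L x + inverse (real (Suc k))) * ?m E n"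
      and "0 < \<epsilon>"
    obtain k where k: "inverse (real (Suc k)) < \<epsilon>" using reals_Archimedean[OF \<open>0 < \<epsilon>\<close>] by blast
    obtain C1 where C1: "\<And>E n. coherent_family x E \<Longrightarrow> ?f E n \<le> C1 + (L x + inverse (real (Suc k))) * ?m E n"
      using up by blast
    obtain C2 where C2: "\<And>E n. coherent_family x E \<Longrightarrow>
        (\<Sum>i<n. LINT z:E i|K i x. - f z) \<le> C2 + (- L x + inverse (real (Suc k))) * ?m E n"
      using low by blast
    show "\<exists>C. \<forall>E n. coherent_family x E \<longrightarrow> \<bar>?f E n - L x * ?m E n\<bar> \<le> C + \<epsilon> * ?m E n"
    proof (intro exI allI impI)
      fix E n assume E: "coherent_family x E"
      have "(\<Sum>i<n. LINT z:E i|K i x. - f z) = - ?f E n"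
        by (simp add: set_lebesgue_integral_def sum_negf)
      moreover have "inverse (real (Suc k)) * ?m E n \<le> \<epsilon> * ?m E n"
        using k by (intro mult_right_mono sum_nonneg) auto
      ultimately show "\<bar>?f E n - L x * ?m E n\<bar> \<le> max C1 C2 + \<epsilon> * ?m E n"
        using C1[OF E, of n] C2[OF E, of n] max.cobounded1[of C1 C2] max.cobounded2[of C2 C1]
        unfolding distrib_right by (intro abs_leI) linarith+
    qed
  qed
qed

end

section \<open>Borel versions of the data and the limit of the averages\<close>

theorem theorem1p4:
  fixes M :: "'a measure" and T :: "'a \<Rightarrow> 'a"
    and \<mu> :: "nat \<Rightarrow> 'a \<Rightarrow> 'a measure" and f :: "'a \<Rightarrow> real"
  assumes "standard_probability_space M"
    and "measure_preserving_map M T"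
    and "iterated_disintegrations M T \<mu>"
    and "integrable (completion M) f"
  shows "AE x in M.
    (\<forall>E\<in>coherent_trees M T \<mu> x. tree_average_finite \<mu> f x E) \<and>
    (\<forall>\<epsilon>>0. \<exists>R. \<forall>E\<in>coherent_trees M T \<mu> x. tree_mass \<mu> x E > R \<longrightarrow>
       \<bar>tree_average \<mu> f x E - real_cond_exp (completion M) (invariant_algebra M T) f x\<bar> < \<epsilon>)"
proof -
  have std: "standard_borel_space M" and prob: "prob_space M"
    using assms(1) by (auto simp: standard_probability_space_def)
  interpret prob_space M by (rule prob)
  have T [measurable]: "T \<in> M \<rightarrow>\<^sub>M M"
    and T_preserves: "\<And>A. A \<in> sets M \<Longrightarrow> measure M (T -` A \<inter> space M) = measure M A"
    using assms(2) by (auto simp: measure_preserving_map_def)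
  have \<mu>_0: "\<And>x. x \<in> space M \<Longrightarrow> \<mu> 0 x = return M x"
    and \<mu>_dis: "\<And>i. i \<ge> 1 \<Longrightarrow> disintegration_over M (T ^^ i) (\<mu> i)"
    using assms(3) by (auto simp: iterated_disintegrations_def)
  have \<mu>_prob: "prob_space (\<mu> i x)" "sets (\<mu> i x) = sets M" if "x \<in> space M" for i x
    using \<mu>_dis[of i] that \<mu>_0[OF that]
    by (cases "i = 0"; auto simp: disintegration_over_def prob_space_return)+
  have T_pow: "T ^^ i \<in> M \<rightarrow>\<^sub>M M" for i
    by (rule measurable_compose_n) (rule T)
  \<comment> \<open>For \<open>i = 0\<close> the version is \<open>return M\<close> itself, because
    the locale fixes the kernel at level \<open>0\<close> at every point and not just almost
    everywhere.\<close>
  have "\<exists>K. K \<in> M \<rightarrow>\<^sub>M prob_algebra M \<and> (AE x in M. K x = \<mu> i x) \<and> (i = 0 \<longrightarrow> K = return M)" for i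
  proof (cases "i = 0")
    case True
    then show ?thesis using \<mu>_0 by (intro exI[of _ "return M"]) auto
  next
    case False
    then have "disintegration_over M (T ^^ i) (\<mu> i)" by (intro \<mu>_dis) simp
    then have "(\<lambda>x. measure (\<mu> i x) E) \<in> borel_measurable (completion M)" if "E \<in> sets M" for E
      using that unfolding disintegration_over_def by (meson borel_measurable_integrable)
    from kernel_borel_version[OF std prob \<mu>_prob this] False show ?thesis by metis
  qed
  then obtain K where K: "\<And>i. K i \<in> M \<rightarrow>\<^sub>M prob_algebra M" "\<And>i. AE x in M. K i x = \<mu> i x"
      "K 0 = return M"
    by metis
  note [measurable] = measurable_prob_algebraD[OF K(1)]
  interpret fibre_kernels M T K
  proof unfold_locales
    fix i E assume [measurable]: "E \<in> sets M"
    show "(\<integral>\<^sup>+x. emeasure (K i x) E \<partial>M) = emeasure M E"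
    proof (cases "i = 0")
      case True
      then show ?thesis by (simp add: K(3))
    next
      case False
      then have dis: "integrable (completion M) (\<lambda>x. measure (\<mu> i x) E)"
          "(\<integral>x. measure (\<mu> i x) E \<partial>completion M) = measure M E"
        using \<mu>_dis[of i] by (auto simp: disintegration_over_def)
      have "(\<integral>\<^sup>+x. emeasure (K i x) E \<partial>M) = (\<integral>\<^sup>+x. ennreal (measure (\<mu> i x) E) \<partial>M)"
      proof (rule nn_integral_cong_AE)
        show "AE x in M. emeasure (K i x) E = ennreal (measure (\<mu> i x) E)"
          using K(2)[of i] AE_space
        proof eventually_elim
          fix x assume "K i x = \<mu> i x" "x \<in> space M"
          interpret \<mu>: prob_space "\<mu> i x" by (rule \<mu>_prob) fact
          show "emeasure (K i x) E = ennreal (measure (\<mu> i x) E)"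
            by (simp add: \<open>K i x = \<mu> i x\<close> \<mu>.emeasure_eq_measure)
        qed
      qed
      also have "\<dots> = ennreal (\<integral>x. measure (\<mu> i x) E \<partial>completion M)"
        using dis(1) by (subst nn_integral_completion[symmetric]) (auto intro!: nn_integral_eq_integral)
      finally show ?thesis by (simp add: dis(2) emeasure_eq_measure)
    qed
  next
    fix i
    show "AE x in M. AE z in K i x. (T ^^ i) z = x"
    proof (cases "i = 0")
      case True
      show ?thesis
        using AE_space
      proof eventually_elim
        fix x assume x: "x \<in> space M"
        then have "{z \<in> space M. z \<noteq> x} \<in> sets M"
          using sets.compl_sets[OF standard_borel_singleton[OF std x]] by (simp add: set_diff_eq)
        then have "AE z in return M x. z = x"
          using x by (subst AE_return) (auto simp: pred_def standard_borel_singleton[OF std] Collect_conv_if)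
        then show "AE z in K i x. (T ^^ i) z = x" unfolding True K(3) by simp
      qed
    next
      case False
      then have "AE x in M. measure (\<mu> i x) (space M - (T ^^ i) -` {x}) = 0"
        using \<mu>_dis[of i] by (auto simp: disintegration_over_def)
      then show ?thesis
        using K(2)[of i] AE_space
      proof eventually_elim
        fix x assume null: "measure (\<mu> i x) (space M - (T ^^ i) -` {x}) = 0"
          and eq: "K i x = \<mu> i x" and x: "x \<in> space M"
        interpret \<mu>: prob_space "\<mu> i x" by (rule \<mu>_prob) fact
        \<comment> \<open>A nonmeasurable set has \<open>measure\<close> zero by default, so
          \<open>null\<close> is informative only once the set is known to be Borel.\<close>
        have "space M - (T ^^ i) -` {x} = space M - ((T ^^ i) -` {x} \<inter> space M)" by auto
        also have "\<dots> \<in> sets M"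
          using measurable_sets[OF T_pow standard_borel_singleton[OF std x]] by auto
        finally have "AE z in \<mu> i x. z \<notin> space M - (T ^^ i) -` {x}"
          using null \<mu>_prob[OF x] by (intro AE_not_in) (simp add: null_sets_def \<mu>.emeasure_eq_measure)
        then show "AE z in K i x. (T ^^ i) z = x"
          unfolding eq using AE_space
          by eventually_elim (use sets_eq_imp_space_eq[OF \<mu>_prob(2)[OF x]] in auto)
      qed
    qed
  qed (use std T_preserves K T in auto)

  let ?F = "invariant_algebra M T"
  let ?L = "real_cond_exp (completion M) ?F f"
  have fin: "finite_measure M" by unfold_locales
  have sets_F: "sets ?F = invariant_sets M T" by (rule sets_invariant_algebra[OF fin T])
  interpret cM: prob_space "completion M"
    by (rule prob_spaceI) (simp add: emeasure_space_1)
  interpret F: finite_measure_subalgebra "completion M" ?F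
    by unfold_locales (rule subalgebra_invariant_algebra[OF fin T])
  \<comment> \<open>The invariant sets are Borel, so the conditional expectation is Borel measurable
    although it is formed over the completion.\<close>
  have "subalgebra M ?F"
    unfolding subalgebra_def sets_F
    by (auto simp: invariant_algebra_def invariant_sets_def space_measure_of_conv)
  then have L_bm [measurable]: "?L \<in> borel_measurable M"
    by (rule measurable_from_subalg) simp
  have L_int: "integrable M ?L"
    using F.real_cond_exp_int(1)[OF assms(4)] by (simp add: integrable_completion)
  have L_inv: "AE z in M. ?L (T z) = ?L z"
    by (rule AE_invariant_function[OF fin T]) simp
  obtain f' where f' [measurable]: "f' \<in> borel_measurable M" and f_eq: "AE x in M. f x = f' x"
    using completion_ex_borel_measurable_real[OF borel_measurable_integrable[OF assms(4)]] by blast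
  have f'_int: "integrable M f'"
  proof -
    have "integrable (completion M) f'"
    proof (rule integrable_cong_AE_imp[OF assms(4) measurable_completion[OF f']])
      show "AE x in completion M. f x = f' x"
        using f_eq unfolding AE_completion_iff .
    qed
    then show ?thesis by (simp add: integrable_completion)
  qed
  have mean: "(LINT x:D|M. f' x) = (LINT x:D|M. ?L x)" if D: "D \<in> invariant_sets M T" for D
  proof -
    have [measurable]: "D \<in> sets M" using D by (simp add: invariant_sets_def)
    have "(LINT x:D|M. f' x) = (LINT x:D|completion M. f x)"
      by (rule set_integral_completion_AE(2)[OF f' _ f'_int f_eq, symmetric]) measurable
    also have "\<dots> = (LINT x:D|completion M. ?L x)"
      using D by (intro F.real_cond_exp_intA[OF assms(4)]) (simp only: sets_F)
    also have "\<dots> = (LINT x:D|M. ?L x)"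
      by (rule set_integral_completion_AE(2)[OF L_bm _ L_int]) simp_all
    finally show ?thesis .
  qed
  have "AE x in M. \<forall>i. K i x = \<mu> i x"
    using K(2) by (simp add: AE_all_countable)
  moreover have "AE x in M. \<forall>i. integrable (K i x) f'"
    by (rule AE_integrable_K) (use f'_int in auto)
  moreover have "AE x in M. \<forall>\<epsilon>>0. \<exists>C. \<forall>E n. coherent_family x E \<longrightarrow>
      \<bar>(\<Sum>i<n. LINT z:E i|K i x. f' z) - ?L x * (\<Sum>i<n. measure (K i x) (E i))\<bar>
        \<le> C + \<epsilon> * (\<Sum>i<n. measure (K i x) (E i))"
    by (rule tree_two_sided_bound[OF f' L_bm f'_int L_int L_inv]) (rule mean)
  \<comment> \<open>On almost every fibre, at all levels at once, \<open>f\<close> agrees almost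
    everywhere with its Borel version.\<close>
  moreover note AE_fibres[OF f_eq] AE_space
  ultimately show ?thesis
  proof eventually_elim
    fix x
    assume K_eq: "\<forall>i. K i x = \<mu> i x" and int: "\<forall>i. integrable (K i x) f'"
      and ae: "\<forall>i. AE z in K i x. f z = f' z"
      and bound: "\<forall>\<epsilon>>0. \<exists>C. \<forall>E n. coherent_family x E \<longrightarrow>
        \<bar>(\<Sum>i<n. LINT z:E i|K i x. f' z) - ?L x * (\<Sum>i<n. measure (K i x) (E i))\<bar>
          \<le> C + \<epsilon> * (\<Sum>i<n. measure (K i x) (E i))"
      and x: "x \<in> space M"
    have \<mu>_eq: "\<mu> i x = K i x" for i using K_eq by simp
    have integrals: "set_integrable (completion (\<mu> i x)) (E ! i) f"
      "(LINT z:E ! i|completion (\<mu> i x). f z) = (LINT z:E ! i|K i x. f' z)"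
      if "E \<in> coherent_trees M T \<mu> x" "i < length E" for E i
    proof -
      have "E ! i \<in> sets M" using that by (simp add: coherent_trees_def)
      then have "E ! i \<in> sets (K i x)" using x by simp
      note * = set_integral_completion_AE[OF borel_measurable_integrable[OF int[rule_format]] this
          int[rule_format] ae[rule_format]]
      show "set_integrable (completion (\<mu> i x)) (E ! i) f"
        "(LINT z:E ! i|completion (\<mu> i x). f z) = (LINT z:E ! i|K i x. f' z)"
        unfolding \<mu>_eq by (rule *)+
    qed
    show "(\<forall>E\<in>coherent_trees M T \<mu> x. tree_average_finite \<mu> f x E) \<and>
      (\<forall>\<epsilon>>0. \<exists>R. \<forall>E\<in>coherent_trees M T \<mu> x. tree_mass \<mu> x E > R \<longrightarrow>
         \<bar>tree_average \<mu> f x E - ?L x\<bar> < \<epsilon>)"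
    proof (intro conjI ballI allI impI)
      fix E assume "E \<in> coherent_trees M T \<mu> x"
      then show "tree_average_finite \<mu> f x E"
        by (simp add: tree_average_finite_def integrals(1))
    next
      fix \<epsilon> :: real assume "0 < \<epsilon>"
      \<comment> \<open>One half of \<open>\<epsilon>\<close> bounds the error per unit of mass; the
        other half absorbs \<open>C\<close> once the mass exceeds
        \<open>2 * C / \<epsilon>\<close>.\<close>
      then obtain C where C: "\<And>E n. coherent_family x E \<Longrightarrow>
        \<bar>(\<Sum>i<n. LINT z:E i|K i x. f' z) - ?L x * (\<Sum>i<n. measure (K i x) (E i))\<bar>
          \<le> C + \<epsilon> / 2 * (\<Sum>i<n. measure (K i x) (E i))"
        using bound[rule_format, of "\<epsilon> / 2"] by auto
      show "\<exists>R. \<forall>E\<in>coherent_trees M T \<mu> x. tree_mass \<mu> x E > R \<longrightarrow> \<bar>tree_average \<mu> f x E - ?L x\<bar> < \<epsilon>"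
      proof (intro exI ballI impI)
        \<comment> \<open>The maximum with \<open>0\<close> makes the mass positive, so that the
          estimate can be divided by it.\<close>
        fix E assume E: "E \<in> coherent_trees M T \<mu> x" and R: "max 0 (2 * C / \<epsilon>) < tree_mass \<mu> x E"
        \<comment> \<open>The locale works with infinite families, so the tree is continued by empty levels.\<close>
        define E' where "E' i = (if i < length E then E ! i else {})" for i
        have "coherent_family x E'"
          unfolding coherent_family_def
        proof (intro conjI allI)
          show "E' i \<in> sets M" "E' 0 \<subseteq> {x}" for i
            using E by (auto simp: E'_def coherent_trees_def)
          fix i
          show "AE z in K (Suc i) x. z \<in> E' (Suc i) \<longrightarrow> T z \<in> E' i"
          proof (cases "Suc i < length E")
            case True
            interpret Ki: prob_space "K (Suc i) x" by (rule prob_space_K[OF x])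
            have "E ! i \<in> sets M" "E ! Suc i \<in> sets M"
              "measure (K (Suc i) x) (E ! Suc i - (T -` (E ! i) \<inter> space M)) = 0"
              using E True by (auto simp: coherent_trees_def \<mu>_eq)
            then have "AE z in K (Suc i) x. z \<notin> E ! Suc i - (T -` (E ! i) \<inter> space M)"
              using x by (intro AE_not_in) (simp add: null_sets_def Ki.emeasure_eq_measure)
            then show ?thesis
              using AE_space by eventually_elim (use True x in \<open>auto simp: E'_def\<close>)
          qed (simp add: E'_def)
        qed
        from C[OF this, of "length E"]
        have le: "\<bar>(\<Sum>i<length E. LINT z:E ! i|completion (\<mu> i x). f z) - ?L x * tree_mass \<mu> x E\<bar>
            \<le> C + \<epsilon> / 2 * tree_mass \<mu> x E"
          by (simp add: E'_def tree_mass_def \<mu>_eq integrals(2)[OF E, unfolded \<mu>_eq])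
        define m where "m = tree_mass \<mu> x E"
        have m: "0 < m" "C < \<epsilon> / 2 * m"
          using R \<open>0 < \<epsilon>\<close> by (simp_all add: m_def field_simps)
        have "tree_average \<mu> f x E - ?L x
            = ((\<Sum>i<length E. LINT z:E ! i|completion (\<mu> i x). f z) - ?L x * m) / m"
          using m(1) unfolding tree_average_def m_def[symmetric] by (simp add: field_simps)
        also have "\<bar>\<dots>\<bar> < \<epsilon>"
          using le m unfolding m_def[symmetric] by (simp add: abs_divide pos_divide_less_eq)
        finally show "\<bar>tree_average \<mu> f x E - ?L x\<bar> < \<epsilon>" .
      qed
    qed
  qed
qed

end
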